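(* Let $\lambda$ be a partition with $\ell(\lambda)$ parts, and let $\mathsf{CS}(\lambda)_{\ell(\lambda)}$ be the induced subgraph of $\mathsf{CS}(\lambda)$ on the vertices $T$ with $\mathsf{Des}(T)$ having exactly $\ell(\lambda)$ parts. Then $\mathsf{CS}(\lambda)_{\ell(\lambda)}$ is isomorphic to the crystal graph $B(\lambda)_{\ell(\lambda)}$. Under this isomorphism, a vertex $T$ with $\alpha=\mathsf{Des}(T)$ is mapped to the tableau $b$ obtained from $T$ by replacing every entry of $\alpha^{(i)}$ by $i$ (for all $i$), so that $\mathsf{Des}(T)$ becomes the weight of $b$; and an edge $T\xrightarrow{I}T'$ with $I=[i,i+2m]$, $I^-=[i,i+m-1]$, $I^+=[i+m+1,i+2m]$, $I^-\cup\{i+m\}\subseteq\alpha^{(j)}$ and $I^+\subseteq\alpha^{(j+1)}$ becomes the crystal edge $b\xrightarrow{j}b'$, i.e. $b'=f_j(b)$.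
   Context: French notation; $|\lambda|=N$; $\mathsf{SYT}(\lambda)$ standard tableaux; $\mathsf{SSYT}(\lambda)_n$ semistandard tableaux with entries in $[n]$; $\mathsf{row}(b)$ reads rows left to right from top row to bottom row; $\mathsf{std}$ replaces the $a_j$ entries $j$, in reading order, by $a_1+\dots+a_{j-1}+1,\dots,a_1+\dots+a_j$. The crystal graph $B(\lambda)_n$ has vertex set $\mathsf{SSYT}(\lambda)_n$ and edges $b\xrightarrow{j}f_j(b)$, where in the subword of $\mathsf{row}(b)$ of letters $j,j+1$ each $j+1$ is bracketed with an unbracketed $j$ to its right (parenthesis matching) and $f_j$ changes the rightmost unbracketed $j$ to $j+1$ (no edge if none); the weight of $b$ is $(a_1,\dots,a_n)$ with $a_j$ the number of entries $j$. For a permutation $\pi$ of $[N]$ and $I=[i,i+2m]\subseteq[N]$, $m\ge1$, $I$ is a Dyck pattern interval of $\pi$ if the RSK insertion tableau of the subword $\pi|_I$ has bottom row $i,\dots,i+m$ and top row $i+m+1,\dots,i+2m$; a Dyck pattern interval of $T$ is one of $\mathsf{row}(T)$. The crystal skeleton $\mathsf{CS}(\lambda)$ is the directed graph on $\mathsf{SYT}(\lambda)$ with, for each Dyck pattern interval $I=[i,i+2m]$ of $T$, an edge $T\xrightarrow{I}\mathsf{std}(f_i(c))$, $c$ obtained from $T$ by replacing entries $i,\dots,i+m$ by $i$ and $i+m+1,\dots,i+2m$ by $i+1$. Descent composition: $d$ is a descent of $T$ if $d+1$ lies in a strictly higher row; for descents $d_1<\dots<d_k$, $\mathsf{Des}(T)=(d_1,d_2-d_1,\dots,N-d_k)$;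 for a composition $\alpha$, $\alpha^{(j)}=\{\alpha_1+\dots+\alpha_{j-1}+1,\dots,\alpha_1+\dots+\alpha_j\}$. *)

theory Defs
  imports Main
begin

text \<open>Tableaux are lists of rows (each a list of entries), in French notation:
  the first row of the list is the bottom (longest) row.\<close>

definition is_partition :: "nat list \<Rightarrow> bool" where
  "is_partition lam \<longleftrightarrow> (\<forall>k\<in>set lam. 0 < k) \<and> sorted_wrt (\<ge>) lam"

definition shape :: "nat list list \<Rightarrow> nat list" where
  "shape T = map length T"

definition row :: "nat list list \<Rightarrow> nat list" where
  "row T = concat (rev T)"

fun split_lens :: "nat list \<Rightarrow> 'a list \<Rightarrow> 'a list list" where
  "split_lens [] w = []"
| "split_lens (k # ks) w = take k w # split_lens ks (drop k w)"

definition unrow :: "nat list \<Rightarrow> nat list \<Rightarrow> nat list list" where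
  "unrow sh w = rev (split_lens (rev sh) w)"

definition cols_strict :: "nat list list \<Rightarrow> bool" where
  "cols_strict T \<longleftrightarrow> (\<forall>r c. Suc r < length T \<and> c < length (T ! Suc r)
      \<longrightarrow> c < length (T ! r) \<and> T ! r ! c < T ! Suc r ! c)"

definition SSYT :: "nat list \<Rightarrow> nat \<Rightarrow> nat list list set" where
  "SSYT lam n = {T. shape T = lam \<and> (\<forall>r\<in>set T. sorted r) \<and> cols_strict T
      \<and> set (concat T) \<subseteq> {1..n}}"

definition SYT :: "nat list \<Rightarrow> nat list list set" where
  "SYT lam = {T. shape T = lam \<and> (\<forall>r\<in>set T. sorted_wrt (<) r) \<and> cols_strict T
      \<and> distinct (concat T) \<and> set (concat T) = {1..sum_list lam}}"

definition weight :: "nat \<Rightarrow> nat list list \<Rightarrow> nat list" where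
  "weight n b = map (\<lambda>j. count_list (row b) j) [1..<Suc n]"

text \<open>Positions (in increasing order) of the unbracketed letters j in a word, where
  each j+1 is bracketed with an unbracketed j to its right (c counts open j+1's, i is the position).\<close>
fun unbr :: "nat \<Rightarrow> nat \<Rightarrow> nat \<Rightarrow> nat list \<Rightarrow> nat list" where
  "unbr j c i [] = []"
| "unbr j c i (x # xs) =
     (if x = Suc j then unbr j (Suc c) (Suc i) xs
      else if x = j then (if 0 < c then unbr j (c - 1) (Suc i) xs else i # unbr j c (Suc i) xs)
      else unbr j c (Suc i) xs)"

definition f_word :: "nat \<Rightarrow> nat list \<Rightarrow> nat list option" where
  "f_word j w = (let u = unbr j 0 0 w in
     if u = [] then None else Some (w[last u := Suc j]))"

definition f_tab :: "nat \<Rightarrow> nat list list \<Rightarrow> nat list list option" where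
  "f_tab j b = map_option (unrow (shape b)) (f_word j (row b))"

definition crystal_edges :: "nat list \<Rightarrow> nat \<Rightarrow> (nat list list \<times> nat \<times> nat list list) set" where
  "crystal_edges lam n = {(b, j, b'). b \<in> SSYT lam n \<and> b' \<in> SSYT lam n \<and> f_tab j b = Some b'}"

definition std_word :: "nat list \<Rightarrow> nat list" where
  "std_word w = map (\<lambda>p. length (filter (\<lambda>y. y < w ! p) w)
      + length (filter (\<lambda>y. y = w ! p) (take p w)) + 1) [0..<length w]"

definition std :: "nat list list \<Rightarrow> nat list list" where
  "std c = unrow (shape c) (std_word (row c))"

fun rins :: "nat \<Rightarrow> nat list list \<Rightarrow> nat list list" where
  "rins x [] = [[x]]"
| "rins x (r # rs) = (let k = length (takeWhile (\<lambda>y. y \<le> x) r) in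
     if k = length r then (r @ [x]) # rs else (r[k := x]) # rins (r ! k) rs)"

definition insertion_tableau :: "nat list \<Rightarrow> nat list list" where
  "insertion_tableau w = foldl (\<lambda>T x. rins x T) [] w"

definition dyck_interval :: "nat list \<Rightarrow> nat \<Rightarrow> nat \<Rightarrow> bool" where
  "dyck_interval p i m \<longleftrightarrow> 1 \<le> m \<and> 1 \<le> i \<and> i + 2 * m \<le> length p \<and>
     insertion_tableau (filter (\<lambda>x. i \<le> x \<and> x \<le> i + 2 * m) p)
       = [[i..<i + m + 1], [i + m + 1..<i + 2 * m + 1]]"

definition merge_int :: "nat \<Rightarrow> nat \<Rightarrow> nat list list \<Rightarrow> nat list list" where
  "merge_int i m T = map (map (\<lambda>x. if i \<le> x \<and> x \<le> i + m then i
      else if i + m < x \<and> x \<le> i + 2 * m then Suc i else x)) T"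

text \<open>Edges of the crystal skeleton CS(lambda); the label (i,m) stands for I = [i, i+2m].\<close>
definition CS_edges :: "nat list \<Rightarrow> (nat list list \<times> (nat \<times> nat) \<times> nat list list) set" where
  "CS_edges lam = {(T, (i, m), T'). T \<in> SYT lam \<and> dyck_interval (row T) i m \<and>
      (\<exists>c'. f_tab i (merge_int i m T) = Some c' \<and> T' = std c')}"

definition row_of :: "nat list list \<Rightarrow> nat \<Rightarrow> nat" where
  "row_of T x = (THE r. r < length T \<and> x \<in> set (T ! r))"

definition descents :: "nat list list \<Rightarrow> nat set" where
  "descents T = {d. 1 \<le> d \<and> d < length (concat T) \<and> row_of T d < row_of T (Suc d)}"

definition Des :: "nat list list \<Rightarrow> nat list" where
  "Des T = (let s = 0 # sorted_list_of_set (descents T) @ [length (concat T)] in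
     map (\<lambda>k. s ! Suc k - s ! k) [0..<length s - 1])"

text \<open>alpha^(j) for j \<ge> 1.\<close>
definition block :: "nat list \<Rightarrow> nat \<Rightarrow> nat set" where
  "block alpha j = {sum_list (take (j - 1) alpha) + 1 .. sum_list (take j alpha)}"

definition destd :: "nat list list \<Rightarrow> nat list list" where
  "destd T = (let alpha = Des T in
     map (map (\<lambda>x. THE j. 1 \<le> j \<and> j \<le> length alpha \<and> x \<in> block alpha j)) T)"

definition CS_vertices_l :: "nat list \<Rightarrow> nat \<Rightarrow> nat list list set" where
  "CS_vertices_l lam l = {T \<in> SYT lam. length (Des T) = l}"

definition CS_edges_l :: "nat list \<Rightarrow> nat \<Rightarrow> (nat list list \<times> (nat \<times> nat) \<times> nat list list) set" where
  "CS_edges_l lam l = {(T, I, T') \<in> CS_edges lam. T \<in> CS_vertices_l lam l \<and> T' \<in> CS_vertices_l lam l}"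

end

theory Submission
  imports Defs
begin

text \<open>
  A vertex is encoded by its reading word \<open>t\<close>, a permutation whose descents are the \<open>d\<close> with
  \<open>d + 1\<close> to the left of \<open>d\<close>; replacing \<open>x\<close> by \<open>1\<close> plus the number of descents below \<open>x\<close>
  inverts standardization. In a semistandard tableau with \<open>\<ell>(\<lambda>)\<close> rows and entries at most \<open>\<ell>(\<lambda>)\<close> the
  first column is \<open>1, \<dots>, \<ell>(\<lambda>)\<close>, so every letter \<open>j < \<ell>(\<lambda>)\<close> is preceded by a \<open>j + 1\<close>, and its
  standardization has a descent between any two consecutive letters.

  An interval \<open>[i, i + 2m]\<close> is a Dyck pattern interval iff its two halves occur in increasing order and
  every upper letter is bracketed. It consists of the last \<open>m + 1\<close> letters \<open>j\<close> and the first \<open>m\<close> letters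
  \<open>j + 1\<close>, and its unique unbracketed letter \<open>x\<close> is the one changed by the crystal operator precisely
  when no further \<open>j + 1\<close> lies to the left of \<open>x\<close>; otherwise the target has one descent too many.
  Conversely \<open>m\<close> is the number of letters \<open>j + 1\<close> before \<open>x\<close> plus the number of letters \<open>j\<close> after \<open>x\<close>.
\<close>

subsection \<open>Standardization and descents of words\<close>

text \<open>A skeleton edge changes a letter of the word in which only the interval is merged, a
  crystal edge a letter of the word in which every block is merged. These words have different
  letters, so they are compared only through the order in which standardization ranks their
  positions. The shape enters only through the first column: it provides every descent between
  consecutive letters, and it puts a \<open>j + 1\<close> before the changed letter, so that the
  descent between \<open>j\<close> and \<open>j + 1\<close> survives the change. The formula for
  \<open>m\<close> gives injectivity on edges, since it involves only the source and the label
  \<open>j\<close>, and \<open>i + m\<close> is the unique descent of level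
  \<open>j\<close>.\<close>

definition is_perm :: "nat list \<Rightarrow> bool" where
  "is_perm t \<longleftrightarrow> distinct t \<and> set t = {1..length t}"

text \<open>The strict total order that ranks the positions of \<open>w\<close> in its
  standardization: by letter, ties broken from left to right.\<close>

definition wless :: "nat list \<Rightarrow> nat \<Rightarrow> nat \<Rightarrow> bool" where
  "wless w p q \<longleftrightarrow> w ! p < w ! q \<or> (w ! p = w ! q \<and> p < q)"

lemma wless_irrefl: "\<not> wless w p p"
  by (simp add: wless_def)

lemma wless_trans: "wless w p q \<Longrightarrow> wless w q r \<Longrightarrow> wless w p r"
  by (auto simp: wless_def)

lemma wless_linear: "p \<noteq> q \<Longrightarrow> wless w p q \<or> wless w q p"
  by (auto simp: wless_def)

lemma length_std_word [simp]: "length (std_word w) = length w"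
  by (simp add: std_word_def)

lemma std_word_nth:
  assumes "p < length w"
  shows "std_word w ! p = Suc (card {q. q < length w \<and> wless w q p})"
proof -
  have "{q. q < length w \<and> wless w q p} =
      {q. q < length w \<and> w ! q < w ! p} \<union> {q. q < length (take p w) \<and> take p w ! q = w ! p}"
    using assms by (auto simp: wless_def)
  moreover have "{q. q < length w \<and> w ! q < w ! p} \<inter> {q. q < length (take p w) \<and> take p w ! q = w ! p} = {}"
    by auto
  ultimately have "card {q. q < length w \<and> wless w q p} =
      card {q. q < length w \<and> w ! q < w ! p} + card {q. q < length (take p w) \<and> take p w ! q = w ! p}"
    by (simp add: card_Un_disjoint)
  then show ?thesis
    using assms by (simp add: std_word_def length_filter_conv_card conj_assoc[symmetric] min_def cong: conj_cong)
qed

lemma std_word_less_iff: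
  assumes "p < length w" "q < length w"
  shows "std_word w ! p < std_word w ! q \<longleftrightarrow> wless w p q"
proof -
  have mono: "std_word w ! p < std_word w ! q" if "wless w p q" "p < length w" "q < length w" for p q
  proof -
    have "{r. r < length w \<and> wless w r p} \<subset> {r. r < length w \<and> wless w r q}"
      using that wless_trans wless_irrefl by blast
    then have "card {r. r < length w \<and> wless w r p} < card {r. r < length w \<and> wless w r q}"
      by (intro psubset_card_mono) auto
    then show ?thesis using that by (simp add: std_word_nth)
  qed
  show ?thesis
    using mono[of p q] mono[of q p] assms wless_linear[of p q w]
    by (metis less_asym less_irrefl)
qed

lemma is_perm_std_word: "is_perm (std_word w)"
proof -
  have d: "distinct (std_word w)"
    unfolding distinct_conv_nth
    by (metis length_std_word less_irrefl std_word_less_iff wless_linear)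
  have "set (std_word w) \<subseteq> {1..length w}"
  proof
    fix x assume "x \<in> set (std_word w)"
    then obtain p where p: "p < length w" "x = std_word w ! p"
      by (metis in_set_conv_nth length_std_word)
    have "{q. q < length w \<and> wless w q p} \<subseteq> {..<length w} - {p}"
      using wless_irrefl by auto
    then have "card {q. q < length w \<and> wless w q p} \<le> length w - 1"
      using p card_mono[of "{..<length w} - {p}"] by fastforce
    then show "x \<in> {1..length w}" using p by (simp add: std_word_nth)
  qed
  then have "set (std_word w) = {1..length w}"
    using d by (intro card_subset_eq) (auto simp: distinct_card)
  then show ?thesis using d by (simp add: is_perm_def)
qed

text \<open>One implication is enough: a strict total order contained in another one on the same
  positions is equal to it.\<close>

lemma std_word_cong:
  assumes len: "length w = length y"
    and imp: "\<And>p q. \<lbrakk>p < length w; q < length w; wless w p q\<rbrakk> \<Longrightarrow> wless y p q"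
  shows "std_word w = std_word y"
proof (rule nth_equalityI)
  fix p assume p: "p < length (std_word w)"
  have "wless w q p \<longleftrightarrow> wless y q p" if "q < length w" for q
    using imp[of p q] imp[of q p] p that
    by (metis length_std_word wless_irrefl wless_linear wless_trans)
  then have "{q. q < length w \<and> wless w q p} = {q. q < length y \<and> wless y q p}"
    using len by auto
  then show "std_word w ! p = std_word y ! p"
    using p len by (simp add: std_word_nth)
qed (simp add: len)

lemma std_word_perm:
  assumes "is_perm t"
  shows "std_word t = t"
proof (rule nth_equalityI)
  fix p assume "p < length (std_word t)"
  then have p: "p < length t" by simp
  have t: "distinct t" "set t = {1..length t}" using assms by (auto simp: is_perm_def)
  have "bij_betw (\<lambda>q. t ! q) {q. q < length t \<and> wless t q p} {1..<t ! p}"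
    unfolding bij_betw_def
  proof
    show "inj_on (\<lambda>q. t ! q) {q. q < length t \<and> wless t q p}"
      using t by (auto simp: inj_on_def nth_eq_iff_index_eq)
    have "t ! p \<le> length t" using t p by (metis atLeastAtMost_iff nth_mem)
    moreover have "wless t q p \<longleftrightarrow> t ! q < t ! p" if "q < length t" for q
      using that p t by (auto simp: wless_def nth_eq_iff_index_eq)
    ultimately have "{q. q < length t \<and> wless t q p} = {q \<in> {..<length t}. t ! q < t ! p}"
      and le: "t ! p \<le> length t"
      by auto
    moreover have "(\<lambda>q. t ! q) ` {q \<in> {..<length t}. t ! q < t ! p} = {y \<in> set t. y < t ! p}"
      by (auto simp: set_conv_nth)
    ultimately show "(\<lambda>q. t ! q) ` {q. q < length t \<and> wless t q p} = {1..<t ! p}"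
      using t(2) by auto
  qed
  then have "card {q. q < length t \<and> wless t q p} = t ! p - 1"
    by (simp add: bij_betw_same_card)
  moreover have "1 \<le> t ! p" using t p by (metis atLeastAtMost_iff nth_mem)
  ultimately show "std_word t ! p = t ! p" using p by (simp add: std_word_nth)
qed simp

section \<open>Descents of a permutation word and the level function\<close>

definition wdes :: "nat list \<Rightarrow> nat set" where
  "wdes t = {d. \<exists>q p. q < p \<and> p < length t \<and> t ! q = Suc d \<and> t ! p = d}"

text \<open>For a letter \<open>x\<close> of \<open>t\<close> this is the index of the block of the
  descent composition that contains \<open>x\<close>, see \<open>block_Des_iff\<close>. Counting
  descents keeps partial sums out of the arguments on words.\<close>

definition lvl :: "nat list \<Rightarrow> nat \<Rightarrow> nat" where
  "lvl t x = Suc (card {d \<in> wdes t. d < x})"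

lemma wdes_subset: "is_perm t \<Longrightarrow> wdes t \<subseteq> {1..<length t}"
  unfolding is_perm_def wdes_def
  by (auto simp: Suc_le_eq) (metis One_nat_def atLeastAtMost_iff nth_mem Suc_le_eq order_less_trans)+

lemma finite_wdes: "is_perm t \<Longrightarrow> finite (wdes t)"
  using wdes_subset finite_subset by blast

lemma lvl_mono: "is_perm t \<Longrightarrow> x \<le> y \<Longrightarrow> lvl t x \<le> lvl t y"
  unfolding lvl_def using finite_wdes[of t] by (auto intro!: card_mono)

lemma lvl_Suc:
  assumes "is_perm t"
  shows "lvl t (Suc x) = (if x \<in> wdes t then Suc (lvl t x) else lvl t x)"
proof -
  have "{d \<in> wdes t. d < Suc x} = (if x \<in> wdes t then insert x {d \<in> wdes t. d < x} else {d \<in> wdes t. d < x})"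
    by (auto simp: less_Suc_eq)
  then show ?thesis using finite_wdes[OF assms] by (simp add: lvl_def)
qed

lemma lvl_pos: "1 \<le> lvl t x"
  by (simp add: lvl_def)

lemma lvl_one: "is_perm t \<Longrightarrow> lvl t 1 = 1"
  using wdes_subset by (fastforce simp: lvl_def)

lemma lvl_length: "is_perm t \<Longrightarrow> lvl t (length t) = Suc (card (wdes t))"
  unfolding lvl_def using wdes_subset[of t] by (auto intro!: arg_cong[where f=card])

lemma lvl_le: "is_perm t \<Longrightarrow> lvl t x \<le> Suc (card (wdes t))"
  unfolding lvl_def using finite_wdes[of t] by (auto intro!: card_mono)

lemma wdes_lvl_less: "is_perm t \<Longrightarrow> d \<in> wdes t \<Longrightarrow> d < x \<Longrightarrow> lvl t d < lvl t x"
  using lvl_mono[of t "Suc d" x] by (simp add: lvl_Suc)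

text \<open>Equal levels mean that no value from \<open>t ! p\<close> to \<open>t ! q - 1\<close> is
  a descent, so each successor stands to the right of its predecessor; the induction on the
  difference of the values chains these steps.\<close>

lemma lvl_eq_order:
  assumes t: "is_perm t" and "p < length t" "q < length t" "t ! p < t ! q" "lvl t (t ! p) = lvl t (t ! q)"
  shows "p < q"
proof -
  have "\<forall>q < length t. t ! q = t ! p + Suc k \<longrightarrow> lvl t (t ! p) = lvl t (t ! q) \<longrightarrow> p < q" for k
  proof (induction k)
    case 0
    show ?case
    proof (intro allI impI)
      fix q assume q: "q < length t" "t ! q = t ! p + Suc 0" "lvl t (t ! p) = lvl t (t ! q)"
      then have "t ! p \<notin> wdes t" using lvl_Suc[OF t, of "t ! p"] by (auto split: if_splits)
      then have "\<not> q < p" using q assms(2) by (auto simp: wdes_def)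
      then show "p < q" using q by (cases "p = q") auto
    qed
  next
    case (Suc k)
    show ?case
    proof (intro allI impI)
      fix q assume q: "q < length t" "t ! q = t ! p + Suc (Suc k)" "lvl t (t ! p) = lvl t (t ! q)"
      have "t ! p + Suc k \<in> set t"
        using t q nth_mem[of q t] by (auto simp: is_perm_def)
      then obtain r where r: "r < length t" "t ! r = t ! p + Suc k" by (metis in_set_conv_nth)
      have a: "lvl t (t ! r) = lvl t (t ! p)"
        using lvl_mono[OF t, of "t ! p" "t ! r"] lvl_mono[OF t, of "t ! r" "t ! q"] q r by simp
      then have "p < r" using Suc r by simp
      moreover have "t ! q = Suc (t ! r)" using q r by simp
      then have "t ! r \<notin> wdes t" using a q lvl_Suc[OF t, of "t ! r"] by (auto split: if_splits)
      then have "\<not> q < r" using r \<open>t ! q = Suc (t ! r)\<close> by (auto simp: wdes_def)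
      ultimately show "p < q" by simp
    qed
  qed
  from this[of "t ! q - t ! p - 1"] assms show ?thesis by simp
qed

lemma lvl_sorted_wrt:
  assumes "is_perm t"
  shows "sorted_wrt (\<lambda>a b. lvl t a = lvl t b \<longrightarrow> a < b) t"
  unfolding sorted_wrt_iff_nth_less
proof (intro allI impI)
  fix q p assume *: "q < p" "p < length t" "lvl t (t ! q) = lvl t (t ! p)"
  have "t ! q \<noteq> t ! p" using * assms by (simp add: is_perm_def nth_eq_iff_index_eq)
  then show "t ! q < t ! p" using lvl_eq_order[OF assms, of p q] * by force
qed

lemma std_word_map_lvl:
  assumes "is_perm t"
  shows "std_word (map (lvl t) t) = t"
proof -
  have "std_word t = std_word (map (lvl t) t)"
  proof (rule std_word_cong)
    fix p q assume pq: "p < length t" "q < length t" "wless t p q"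
    then have "t ! p < t ! q" using assms by (auto simp: wless_def is_perm_def nth_eq_iff_index_eq)
    then show "wless (map (lvl t) t) p q"
      using pq lvl_mono[OF assms, of "t ! p" "t ! q"] lvl_eq_order[OF assms, of p q]
      by (auto simp: wless_def le_less)
  qed simp
  then show ?thesis using std_word_perm[OF assms] by simp
qed

text \<open>The letters of \<open>w\<close>, listed in the order of the values of \<open>t\<close>,
  form a weakly increasing sequence \<open>g\<close> onto 1, ..., l. Its steps are therefore 0 or 1.
  Descents of \<open>t\<close> occur only at steps of 1, and \<open>wk\<close> makes each such step
  a descent, so counting descents recovers the letter.\<close>

lemma lvl_std_word:
  assumes set: "set w = {1..l}" and l: "1 \<le> l"
    and wk: "\<And>j. \<lbrakk>1 \<le> j; j < l\<rbrakk> \<Longrightarrow> \<exists>q p. q < p \<and> p < length w \<and> w ! q = Suc j \<and> w ! p = j"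
    and t: "t = std_word w"
  shows "map (lvl t) t = w" and "card (wdes t) = l - 1"
proof -
  have perm: "is_perm t" and len: "length t = length w"
    using t is_perm_std_word by auto
  have dt: "distinct t" and st: "set t = {1..length w}" using perm len by (auto simp: is_perm_def)
  define g where "g x = w ! (THE p. p < length t \<and> t ! p = x)" for x
  have gt: "g (t ! p) = w ! p" if "p < length w" for p
  proof -
    have "(THE p'. p' < length t \<and> t ! p' = t ! p) = p"
      using that len dt by (intro the_equality) (auto simp: nth_eq_iff_index_eq)
    then show ?thesis by (simp add: g_def)
  qed
  have pos: "\<exists>p < length w. t ! p = x" if "x \<in> {1..length w}" for x
    using that st len by (metis in_set_conv_nth)
  have gmono: "g x \<le> g y" if xy: "x \<in> {1..length w}" "y \<in> {1..length w}" "x \<le> y" for x y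
  proof (cases "x = y")
    case False
    obtain p q where p: "p < length w" "t ! p = x" and q: "q < length w" "t ! q = y"
      using pos xy by metis
    then have "wless w p q" using False xy std_word_less_iff[of p w q] t by simp
    then show ?thesis using gt p q by (metis wless_def less_imp_le order_refl)
  qed simp
  have grange: "g x \<in> {1..l}" if x: "x \<in> {1..length w}" for x
  proof -
    obtain p where "p < length w" "t ! p = x" using pos[OF x] by blast
    then show ?thesis using gt[of p] set nth_mem[of p w] by simp
  qed
  have gsurj: "\<exists>x \<in> {1..length w}. g x = a" if a: "a \<in> {1..l}" for a
  proof -
    obtain p where p: "p < length w" "w ! p = a" using a set by (metis in_set_conv_nth)
    then have "t ! p \<in> {1..length w}" using st len nth_mem[of p t] by simp
    then show ?thesis using gt p by blast
  qed
  have N: "1 \<le> length w" using set l by (cases w) auto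
  have g1: "g 1 = 1"
  proof -
    obtain x where "x \<in> {1..length w}" "g x = 1" using gsurj[of 1] l by auto
    then show ?thesis using gmono[of 1 x] grange[of 1] N by simp
  qed
  have gN: "g (length w) = l"
  proof -
    obtain x where "x \<in> {1..length w}" "g x = l" using gsurj[of l] l by auto
    then show ?thesis using gmono[of x "length w"] grange[of "length w"] N by simp
  qed
  have gstep: "g (Suc d) \<le> Suc (g d)" if d: "1 \<le> d" "d < length w" for d
  proof (rule ccontr)
    assume "\<not> ?thesis"
    then have "Suc (g d) < g (Suc d)" by simp
    moreover have "g (Suc d) \<le> l" using grange[of "Suc d"] d by simp
    ultimately obtain x where x: "x \<in> {1..length w}" "g x = Suc (g d)" using gsurj[of "Suc (g d)"] by auto
    show False
    proof (cases "x \<le> d")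
      case True then show ?thesis using gmono[of x d] x d by simp
    next
      case False then show ?thesis using gmono[of "Suc d" x] x d \<open>Suc (g d) < g (Suc d)\<close> by simp
    qed
  qed
  have des: "d \<in> wdes t \<longleftrightarrow> g d < g (Suc d)" if d: "1 \<le> d" "d < length w" for d
  proof
    assume "d \<in> wdes t"
    then obtain q p where qp: "q < p" "p < length w" "t ! q = Suc d" "t ! p = d"
      using len by (auto simp: wdes_def)
    then have "wless w p q" using std_word_less_iff[of p w q] t by simp
    then show "g d < g (Suc d)" using qp gt[of q] gt[of p] by (auto simp: wless_def)
  next
    assume lt: "g d < g (Suc d)"
    then have eq: "g (Suc d) = Suc (g d)" using gstep[OF d] by simp
    have "1 \<le> g d" "g d < l" using grange[of d] grange[of "Suc d"] d lt by auto
    from wk[OF this] obtain q p where qp: "q < p" "p < length w" "w ! q = Suc (g d)" "w ! p = g d"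
      by blast
    obtain q' p' where q': "q' < length w" "t ! q' = Suc d" and p': "p' < length w" "t ! p' = d"
      using pos[of "Suc d"] pos[of d] d by auto
    have wq': "w ! q' = Suc (g d)" and wp': "w ! p' = g d" using gt q' p' eq by metis+
    have "q' \<le> q"
    proof (rule ccontr)
      assume "\<not> ?thesis"
      then have "wless w q q'" using wq' qp by (simp add: wless_def)
      then have "t ! q < Suc d" using std_word_less_iff[of q w q'] t q' qp by simp
      then have "g (t ! q) \<le> g d" using qp st len d nth_mem[of q t] by (intro gmono) auto
      then show False using gt[of q] qp by simp
    qed
    moreover have "p \<le> p'"
    proof (rule ccontr)
      assume "\<not> ?thesis"
      then have "wless w p' p" using wp' qp by (simp add: wless_def)
      then have "d < t ! p" using std_word_less_iff[of p' w p] t p' qp by simp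
      then have "g (Suc d) \<le> g (t ! p)" using qp st len d nth_mem[of p t] by (intro gmono) auto
      then show False using gt[of p] qp eq by simp
    qed
    ultimately have "q' < p'" using qp by simp
    then show "d \<in> wdes t" using q' p' len by (auto simp: wdes_def)
  qed
  have lvl: "lvl t x = g x" if "1 \<le> x" "x \<le> length w" for x
    using that
  proof (induction x rule: dec_induct)
    case base
    then show ?case using lvl_one[OF perm] g1 by simp
  next
    case (step x)
    then show ?case
      using des[of x] lvl_Suc[OF perm, of x] gstep[of x] gmono[of x "Suc x"]
      by (cases "x \<in> wdes t") auto
  qed
  show "map (lvl t) t = w"
  proof (rule nth_equalityI)
    fix p assume "p < length (map (lvl t) t)"
    then show "map (lvl t) t ! p = w ! p"
      using len lvl[of "t ! p"] gt[of p] st nth_mem[of p t] by auto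
  qed (simp add: len)
  show "card (wdes t) = l - 1"
    using lvl_length[OF perm] lvl[of "length w"] gN len N by simp
qed

subsection \<open>Bracketing\<close>

text \<open>Letters satisfying \<open>Q\<close> open a bracket, letters satisfying \<open>P\<close>
  close one. The suffix condition says that no opening bracket of \<open>u\<close> stays unmatched,
  the prefix condition below that no closing one does. Predicates let the conditions serve both for
  levels and for the halves of an interval.\<close>

definition suffix_dom :: "('a \<Rightarrow> bool) \<Rightarrow> ('a \<Rightarrow> bool) \<Rightarrow> 'a list \<Rightarrow> bool" where
  "suffix_dom P Q u \<longleftrightarrow> (\<forall>n. length (filter Q (drop n u)) \<le> length (filter P (drop n u)))"

definition prefix_dom :: "('a \<Rightarrow> bool) \<Rightarrow> ('a \<Rightarrow> bool) \<Rightarrow> 'a list \<Rightarrow> bool" where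
  "prefix_dom P Q u \<longleftrightarrow> (\<forall>n. length (filter P (take n u)) \<le> length (filter Q (take n u)))"

text \<open>Number of brackets open after \<open>u\<close> when \<open>c\<close> are open before it;
  truncated subtraction ignores a closing bracket without partner.\<close>

definition opn :: "('a \<Rightarrow> bool) \<Rightarrow> ('a \<Rightarrow> bool) \<Rightarrow> nat \<Rightarrow> 'a list \<Rightarrow> nat" where
  "opn P Q = foldl (\<lambda>c x. if Q x then Suc c else if P x then c - 1 else c)"

lemma suffix_dom_map: "suffix_dom P Q (map f u) \<longleftrightarrow> suffix_dom (\<lambda>x. P (f x)) (\<lambda>x. Q (f x)) u"
  by (simp add: suffix_dom_def drop_map filter_map o_def)

lemma prefix_dom_map: "prefix_dom P Q (map f u) \<longleftrightarrow> prefix_dom (\<lambda>x. P (f x)) (\<lambda>x. Q (f x)) u"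
  by (simp add: prefix_dom_def take_map filter_map o_def)

lemma suffix_dom_append: "suffix_dom P Q u \<Longrightarrow> suffix_dom P Q v \<Longrightarrow> suffix_dom P Q (u @ v)"
  unfolding suffix_dom_def by (simp add: add_mono)

lemma suffix_dom_appendD: "suffix_dom P Q (u @ v) \<Longrightarrow> suffix_dom P Q v"
  unfolding suffix_dom_def by (metis append_Nil drop_drop append_eq_conv_conj)

lemma suffix_dom_length: "suffix_dom P Q u \<Longrightarrow> length (filter Q u) \<le> length (filter P u)"
  unfolding suffix_dom_def by (metis drop0)

lemma prefix_dom_length: "prefix_dom P Q u \<Longrightarrow> length (filter P u) \<le> length (filter Q u)"
  unfolding prefix_dom_def by (metis order_refl take_all_iff)

text \<open>A suffix is the complement of a prefix: a prefix without surplus of \<open>P\<close>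
  leaves a suffix without surplus of \<open>Q\<close>, provided the total has none.\<close>

lemma prefix_dom_imp_suffix_dom:
  assumes "prefix_dom P Q u" "length (filter Q u) \<le> length (filter P u)"
  shows "suffix_dom P Q u"
  unfolding suffix_dom_def
proof
  fix n
  have "length (filter R u) = length (filter R (take n u)) + length (filter R (drop n u))" for R
    by (metis append_take_drop_id filter_append length_append)
  from this[of P] this[of Q] show "length (filter Q (drop n u)) \<le> length (filter P (drop n u))"
    using assms(2) spec[OF assms(1)[unfolded prefix_dom_def], of n] by linarith
qed

lemma suffix_dom_mono:
  assumes "suffix_dom P Q u"
    and "\<And>x. x \<in> set u \<Longrightarrow> P x \<Longrightarrow> P' x" "\<And>x. x \<in> set u \<Longrightarrow> Q' x \<Longrightarrow> Q x"
  shows "suffix_dom P' Q' u"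
  unfolding suffix_dom_def
proof
  fix n
  have mono: "length (filter R v) \<le> length (filter R' v)" if "\<And>x. x \<in> set v \<Longrightarrow> R x \<Longrightarrow> R' x"
    for R R' :: "'a \<Rightarrow> bool" and v using that by (induction v) auto
  have "length (filter Q' (drop n u)) \<le> length (filter Q (drop n u))"
    by (rule mono) (metis assms(2,3) in_set_dropD)
  also have "\<dots> \<le> length (filter P (drop n u))" using assms by (simp add: suffix_dom_def)
  also have "\<dots> \<le> length (filter P' (drop n u))"
    by (rule mono) (metis assms(2,3) in_set_dropD)
  finally show "length (filter Q' (drop n u)) \<le> length (filter P' (drop n u))" .
qed

lemma prefix_dom_mono:
  assumes "prefix_dom P Q u"
    and "\<And>x. x \<in> set u \<Longrightarrow> P' x \<Longrightarrow> P x" "\<And>x. x \<in> set u \<Longrightarrow> Q x \<Longrightarrow> Q' x"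
  shows "prefix_dom P' Q' u"
  unfolding prefix_dom_def
proof
  fix n
  have mono: "length (filter R v) \<le> length (filter R' v)" if "\<And>x. x \<in> set v \<Longrightarrow> R x \<Longrightarrow> R' x"
    for R R' :: "'a \<Rightarrow> bool" and v using that by (induction v) auto
  have "length (filter P' (take n u)) \<le> length (filter P (take n u))"
    by (rule mono) (metis assms(2,3) in_set_takeD)
  also have "\<dots> \<le> length (filter Q (take n u))" using assms by (simp add: prefix_dom_def)
  also have "\<dots> \<le> length (filter Q' (take n u))"
    by (rule mono) (metis assms(2,3) in_set_takeD)
  finally show "length (filter P' (take n u)) \<le> length (filter Q' (take n u))" .
qed

lemma opn_snoc: "opn P Q c (u @ [x]) =
    (if Q x then Suc (opn P Q c u) else if P x then opn P Q c u - 1 else opn P Q c u)"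
  by (simp add: opn_def)

text \<open>The number of open brackets is the largest surplus of \<open>Q\<close> over
  \<open>P\<close> in a suffix. The bound \<open>k\<close> is arbitrary because appending an opening
  or closing letter shifts it by one.\<close>

lemma opn_le_iff:
  assumes "\<And>x. \<not> (P x \<and> Q x)"
  shows "opn P Q 0 u \<le> k \<longleftrightarrow> (\<forall>n. length (filter Q (drop n u)) \<le> k + length (filter P (drop n u)))"
proof (induction u arbitrary: k rule: rev_induct)
  case Nil
  then show ?case by (simp add: opn_def)
next
  case (snoc x u)
  \<comment> \<open>The suffixes of \<open>u @ [x]\<close> are those of \<open>u\<close> extended by
    \<open>x\<close>, and the empty one, for which the bound is trivial.\<close>
  have R: "(\<forall>n. length (filter Q (drop n (u @ [x]))) \<le> k + length (filter P (drop n (u @ [x])))) \<longleftrightarrow>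
     (\<forall>n. length (filter Q (drop n u @ [x])) \<le> k + length (filter P (drop n u @ [x])))" (is "?A \<longleftrightarrow> ?B")
  proof
    assume A: ?A
    show ?B
    proof
      fix n
      have "drop (min n (length u)) (u @ [x]) = drop n u @ [x]" by (simp add: min_def)
      then show "length (filter Q (drop n u @ [x])) \<le> k + length (filter P (drop n u @ [x]))"
        using A by metis
    qed
  next
    assume B: ?B
    show ?A
    proof
      fix n
      show "length (filter Q (drop n (u @ [x]))) \<le> k + length (filter P (drop n (u @ [x])))"
      proof (cases "n \<le> length u")
        case True then show ?thesis using B by simp
      qed simp
    qed
  qed
  show ?case
  proof (cases "Q x")
    case True
    then have nP: "\<not> P x" using assms by blast
    show ?thesis
    proof (cases k)
      case 0
      have "\<not> (\<forall>n. length (filter Q (drop n u @ [x])) \<le> k + length (filter P (drop n u @ [x])))"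
        using True nP 0 by (intro notI) (drule spec[of _ "length u"], simp)
      then show ?thesis using R 0 True by (simp add: opn_snoc)
    next
      case (Suc k')
      then show ?thesis using True nP snoc[of k'] unfolding R by (simp add: opn_snoc)
    qed
  next
    case nQ: False
    show ?thesis
    proof (cases "P x")
      case True
      have "opn P Q 0 u - 1 \<le> k \<longleftrightarrow> opn P Q 0 u \<le> Suc k" by auto
      then show ?thesis using nQ True snoc[of "Suc k"] unfolding R by (simp add: opn_snoc)
    next
      case False
      then show ?thesis using nQ snoc[of k] unfolding R by (simp add: opn_snoc)
    qed
  qed
qed

lemma opn_eq_0_iff:
  assumes "\<And>x. \<not> (P x \<and> Q x)"
  shows "opn P Q 0 u = 0 \<longleftrightarrow> suffix_dom P Q u"
  using opn_le_iff[of P Q u 0] assms by (simp add: suffix_dom_def)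

lemma opn_filter:
  assumes "\<And>x. P x \<or> Q x \<Longrightarrow> R x"
  shows "opn P Q c (filter R u) = opn P Q c u"
  using assms by (induction u arbitrary: c) (auto simp: opn_def)

section \<open>The crystal operator on words\<close>

abbreviation (input) "jopn j \<equiv> opn (\<lambda>x. x = j) (\<lambda>x. x = Suc j)"

lemma unbr_append: "unbr j c i (u @ v) = unbr j c i u @ unbr j (jopn j c u) (i + length u) v"
  by (induction j c i u rule: unbr.induct) (auto simp: opn_def)

lemma unbr_eq_Nil_iff:
  "unbr j c i v = [] \<longleftrightarrow> (\<forall>n. length (filter (\<lambda>x. x = j) (take n v)) \<le> c + length (filter (\<lambda>x. x = Suc j) (take n v)))"
proof (induction j c i v rule: unbr.induct)
  case (2 j c i x xs)
  have R: "(\<forall>n. F (take n (x # xs))) \<longleftrightarrow> F [] \<and> (\<forall>n. F (x # take n xs))" for F :: "nat list \<Rightarrow> bool"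
    by (metis take0 take_Suc_Cons not0_implies_Suc)
  show ?case
    unfolding R[where F="\<lambda>y. length (filter (\<lambda>x. x = j) y) \<le> c + length (filter (\<lambda>x. x = Suc j) y)"]
    using 2 by (cases c) (auto intro: exI[of _ 0])
qed simp

text \<open>The word is cut at its last unbracketed \<open>j\<close>. No bracket is open when that
  letter is met, since otherwise it would be matched; so the scan of the rest restarts from 0 and
  finds nothing unbracketed.\<close>

lemma unbr_split:
  assumes "unbr j c i w \<noteq> []"
  shows "\<exists>u v. w = u @ j # v \<and> jopn j c u = 0 \<and> unbr j 0 (Suc (i + length u)) v = []
     \<and> last (unbr j c i w) = i + length u"
  using assms
proof (induction j c i w rule: unbr.induct)
  case (2 j c i x xs)
  let ?goal = "\<lambda>c' u v. xs = u @ j # v \<and> jopn j c' u = 0 \<and> unbr j 0 (Suc (Suc i + length u)) v = []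
     \<and> last (unbr j c' (Suc i) xs) = Suc i + length u"
  consider "x = Suc j" | "x = j" "0 < c" | "x = j" "c = 0" | "x \<noteq> j" "x \<noteq> Suc j" by blast
  then show ?case
  proof cases
    case 1
    then obtain u v where "?goal (Suc c) u v" using "2.IH"(1) "2.prems" by auto
    then show ?thesis using 1 by (intro exI[of _ "x # u"] exI[of _ v]) (auto simp: opn_def)
  next
    case 2
    then obtain u v where "?goal (c - 1) u v" using "2.IH"(2) "2.prems" by auto
    then show ?thesis using 2 by (intro exI[of _ "x # u"] exI[of _ v]) (auto simp: opn_def)
  next
    case 3
    show ?thesis
    proof (cases "unbr j c (Suc i) xs = []")
      case True
      then show ?thesis using 3 by (intro exI[of _ "[]"] exI[of _ xs]) (auto simp: opn_def)
    next
      case False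
      then obtain u v where "?goal c u v" using "2.IH"(3) 3 by auto
      then show ?thesis using 3 False by (intro exI[of _ "x # u"] exI[of _ v]) (auto simp: opn_def)
    qed
  next
    case 4
    then obtain u v where "?goal c u v" using "2.IH"(4) "2.prems" by auto
    then show ?thesis using 4 by (intro exI[of _ "x # u"] exI[of _ v]) (auto simp: opn_def)
  qed
qed simp

lemma last_unbr:
  assumes "suffix_dom (\<lambda>x. x = j) (\<lambda>x. x = Suc j) u" "prefix_dom (\<lambda>x. x = j) (\<lambda>x. x = Suc j) v"
  shows "unbr j 0 0 (u @ j # v) \<noteq> []" "last (unbr j 0 0 (u @ j # v)) = length u"
proof -
  have "jopn j 0 u = 0" using assms(1) by (subst opn_eq_0_iff) auto
  moreover have "unbr j 0 (Suc (length u)) v = []"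
    using assms(2) by (simp add: unbr_eq_Nil_iff prefix_dom_def)
  ultimately have "unbr j 0 0 (u @ j # v) = unbr j 0 0 u @ [length u]"
    by (simp add: unbr_append)
  then show "unbr j 0 0 (u @ j # v) \<noteq> []" "last (unbr j 0 0 (u @ j # v)) = length u" by auto
qed

text \<open>The scan becomes a factorization: the changed letter is the \<open>j\<close> such that
  every \<open>j + 1\<close> on its left is matched on the left and every \<open>j\<close> on its
  right is matched on the right.\<close>

lemma f_word_iff:
  "f_word j w = Some w' \<longleftrightarrow> (\<exists>u v. w = u @ j # v \<and> w' = u @ Suc j # v
     \<and> suffix_dom (\<lambda>x. x = j) (\<lambda>x. x = Suc j) u \<and> prefix_dom (\<lambda>x. x = j) (\<lambda>x. x = Suc j) v)"
proof
  assume "f_word j w = Some w'"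
  then have ne: "unbr j 0 0 w \<noteq> []" and w': "w' = w[last (unbr j 0 0 w) := Suc j]"
    by (auto simp: f_word_def Let_def split: if_splits)
  from unbr_split[OF ne] obtain u v where uv: "w = u @ j # v" "jopn j 0 u = 0"
    "unbr j 0 (Suc (0 + length u)) v = []" "last (unbr j 0 0 w) = 0 + length u" by blast
  have "suffix_dom (\<lambda>x. x = j) (\<lambda>x. x = Suc j) u" using uv(2) by (subst opn_eq_0_iff[symmetric]) auto
  moreover have "prefix_dom (\<lambda>x. x = j) (\<lambda>x. x = Suc j) v"
    using uv(3) by (simp add: unbr_eq_Nil_iff prefix_dom_def)
  moreover have "w' = u @ Suc j # v" using w' uv by simp
  ultimately show "\<exists>u v. w = u @ j # v \<and> w' = u @ Suc j # v
     \<and> suffix_dom (\<lambda>x. x = j) (\<lambda>x. x = Suc j) u \<and> prefix_dom (\<lambda>x. x = j) (\<lambda>x. x = Suc j) v"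
    using uv(1) by blast
next
  assume "\<exists>u v. w = u @ j # v \<and> w' = u @ Suc j # v
     \<and> suffix_dom (\<lambda>x. x = j) (\<lambda>x. x = Suc j) u \<and> prefix_dom (\<lambda>x. x = j) (\<lambda>x. x = Suc j) v"
  then show "f_word j w = Some w'"
    by (elim exE conjE) (simp add: f_word_def Let_def last_unbr)
qed

text \<open>Pulled back to \<open>t\<close>, the factorization can be compared for two maps, levels
  and merged letters, at the same letter \<open>x\<close>.\<close>

lemma f_word_map_iff:
  "f_word j (map f t) = Some w' \<longleftrightarrow> (\<exists>t1 x t2. t = t1 @ x # t2 \<and> f x = j \<and> w' = map f t1 @ Suc j # map f t2
     \<and> suffix_dom (\<lambda>x. f x = j) (\<lambda>x. f x = Suc j) t1 \<and> prefix_dom (\<lambda>x. f x = j) (\<lambda>x. f x = Suc j) t2)"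
  unfolding f_word_iff
proof (safe, goal_cases)
  case (1 u v)
  then obtain t1 t' where "t = t1 @ t'" "u = map f t1" "j # v = map f t'"
    by (auto simp: map_eq_append_conv)
  moreover then obtain x t2 where "t' = x # t2" "f x = j" "v = map f t2" by auto
  ultimately show ?case using 1 by (auto simp: suffix_dom_map prefix_dom_map)
next
  case (2 t1 x t2)
  then show ?case by (intro exI[of _ "map f t1"] exI[of _ "map f t2"]) (simp add: suffix_dom_map prefix_dom_map)
qed

subsection \<open>Insertion tableaux of Dyck pattern intervals\<close>

lemma rins_append: "\<forall>y\<in>set r. y \<le> x \<Longrightarrow> rins x (r # rs) = (r @ [x]) # rs"
  by (simp add: Let_def takeWhile_eq_all_conv[THEN iffD2])

lemma rins_bump:
  assumes "\<forall>z\<in>set xs. z \<le> x" "x < y"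
  shows "rins x ((xs @ y # ys) # rs) = (xs @ x # ys) # rins y rs"
proof -
  have "takeWhile (\<lambda>z. z \<le> x) (xs @ y # ys) = xs"
    using assms by (subst takeWhile_append2) auto
  then show ?thesis by (simp add: Let_def)
qed

declare rins.simps(2) [simp del]

lemma row_split:
  fixes x :: nat
  obtains "\<forall>y\<in>set r. y \<le> x" | xs y ys where "r = xs @ y # ys" "\<forall>z\<in>set xs. z \<le> x" "x < y"
proof (cases "\<forall>y\<in>set r. y \<le> x")
  case False
  then have "\<exists>y\<in>set r. x < y" by force
  then obtain xs y ys where "r = xs @ y # ys" "x < y" "\<forall>z\<in>set xs. \<not> x < z"
    using split_list_first_prop[of r "\<lambda>y. x < y"] by blast
  then show ?thesis using that(2)[of xs y ys] by (simp add: not_less)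
qed (use that in blast)

lemma rins_not_Nil: "rins x T \<noteq> []"
  by (cases T) (auto simp: Let_def rins.simps(2))

lemma rins_rows:
  assumes "\<forall>r\<in>set T. r \<noteq> [] \<and> sorted r"
  shows "\<forall>r\<in>set (rins x T). r \<noteq> [] \<and> sorted r"
  using assms
proof (induction T arbitrary: x)
  case (Cons r rs)
  show ?case
  proof (rule row_split[of r x])
    assume "\<forall>y\<in>set r. y \<le> x"
    then show ?thesis using Cons.prems by (simp only: rins_append) (auto simp: sorted_append)
  next
    fix xs y ys assume *: "r = xs @ y # ys" "\<forall>z\<in>set xs. z \<le> x" "x < y"
    then have "sorted (xs @ x # ys)" using Cons.prems by (auto simp: sorted_append)
    moreover have "rins x (r # rs) = (xs @ x # ys) # rins y rs"
      unfolding *(1) by (rule rins_bump) (use * in auto)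
    ultimately show ?thesis using Cons.IH[of y] Cons.prems by simp
  qed
qed simp

lemma insertion_tableau_snoc: "insertion_tableau (u @ [x]) = rins x (insertion_tableau u)"
  by (simp add: insertion_tableau_def)

lemma insertion_tableau_rows: "\<forall>r\<in>set (insertion_tableau u). r \<noteq> [] \<and> sorted r"
proof (induction u rule: rev_induct)
  case Nil
  then show ?case by (simp add: insertion_tableau_def)
next
  case (snoc x u)
  then show ?case unfolding insertion_tableau_snoc by (rule rins_rows)
qed

text \<open>At most two rows, bottom \<open>R\<close> and top \<open>C\<close>, where an absent row
  counts as empty. One invariant thus covers the stages before the second row exists.\<close>

definition two_rows :: "nat list list \<Rightarrow> nat list \<Rightarrow> nat list \<Rightarrow> bool" where
  "two_rows T R C \<longleftrightarrow> T = [] \<and> R = [] \<and> C = [] \<or> R \<noteq> [] \<and> (T = [R] \<and> C = [] \<or> T = [R, C] \<and> C \<noteq> [])"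

lemma two_rows_append:
  assumes "two_rows T R C" "\<forall>y\<in>set R. y \<le> x"
  shows "two_rows (rins x T) (R @ [x]) C"
  using assms by (auto simp: two_rows_def rins_append)

lemma two_rows_bump:
  assumes "two_rows T (xs @ y # ys) C" "\<forall>z\<in>set xs. z \<le> x" "x < y" "\<forall>z\<in>set C. z \<le> y"
  shows "two_rows (rins x T) (xs @ x # ys) (C @ [y])"
  using assms by (auto simp: two_rows_def rins_append rins_bump)

text \<open>Reverse insertion: if the result has at most two rows, the last step appended to the
  bottom row or bumped one entry that was appended to the top row, since a second bump would create
  a third row.\<close>

lemma two_rows_rinsE:
  assumes "two_rows (rins x T) R C" "\<forall>r\<in>set T. r \<noteq> []"
  obtains (append) R' where "R = R' @ [x]" "two_rows T R' C"
  | (bump) xs y ys C' where "R = xs @ x # ys" "C = C' @ [y]" "x < y" "two_rows T (xs @ y # ys) C'"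
proof (cases T)
  case Nil
  then show ?thesis using assms append[of "[]"] by (auto simp: two_rows_def)
next
  case (Cons r rs)
  show ?thesis
  proof (rule row_split[of r x])
    assume "\<forall>y\<in>set r. y \<le> x"
    then show ?thesis using assms Cons append[of r]
      by (auto simp: two_rows_def rins_append)
  next
    fix xs y ys assume *: "r = xs @ y # ys" "\<forall>z\<in>set xs. z \<le> x" "x < y"
    have R: "rins x T = (xs @ x # ys) # rins y rs"
      unfolding Cons *(1) by (rule rins_bump) (use * in auto)
    then have R1: "R = xs @ x # ys" and R2: "rins y rs = [C]" "C \<noteq> []"
      using assms(1) rins_not_Nil[of y rs] by (auto simp: two_rows_def)
    show ?thesis
    proof (cases rs)
      case Nil
      then show ?thesis using bump[OF R1, of "[]" y] * Cons R2 by (auto simp: two_rows_def)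
    next
      case (Cons r' rs')
      show ?thesis
      proof (rule row_split[of r' y])
        assume "\<forall>z\<in>set r'. z \<le> y"
        then have "C = r' @ [y]" "rs' = []"
          using R2 Cons by (auto simp: rins_append)
        then show ?thesis
          using bump[OF R1, of r' y] * Cons \<open>T = r # rs\<close> assms(2) by (auto simp: two_rows_def)
      next
        fix xs' y' ys' assume "r' = xs' @ y' # ys'" "\<forall>z\<in>set xs'. z \<le> y" "y < y'"
        then have "rins y rs = (xs' @ y # ys') # rins y' rs'" using Cons rins_bump by simp
        then show ?thesis using R2 rins_not_Nil[of y' rs'] by simp
      qed
    qed
  qed
qed

lemma upt_eq_snocD:
  assumes "[i..<i + a] = ys @ [x]"
  obtains a' where "a = Suc a'" "x = i + a'" "ys = [i..<i + a']"
  using assms by (cases a) auto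

text \<open>At every stage the bottom row consists of the lower letters read so far followed by the
  upper letters still open, and the top row holds the closed upper letters: a lower letter bumps the
  smallest open upper letter, if there is one. So \<open>b - q\<close> is the number of open
  brackets. The induction undoes the last insertion.\<close>

lemma two_rows_insertionD:
  assumes "two_rows (insertion_tableau u) ([i..<i + a] @ [h + q..<h + b]) [h..<h + q]" "i + a \<le> h" "q \<le> b"
  shows "filter (\<lambda>x. x < h) u = [i..<i + a] \<and> filter (\<lambda>x. h \<le> x) u = [h..<h + b]
    \<and> opn (\<lambda>x. x < h) (\<lambda>x. h \<le> x) 0 u = b - q"
  using assms
proof (induction u arbitrary: a q b rule: rev_induct)
  case Nil
  then show ?case by (auto simp: two_rows_def insertion_tableau_def opn_def)
next
  case (snoc x u)
  let ?T = "insertion_tableau u"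
  have T: "\<forall>r\<in>set ?T. r \<noteq> []" "\<forall>r\<in>set ?T. sorted r" using insertion_tableau_rows by auto
  show ?case
    using snoc.prems(1)[unfolded insertion_tableau_snoc] T(1)
  proof (cases rule: two_rows_rinsE)
    case (append R')
    show ?thesis
    proof (cases "q < b")
      case True
      then obtain b' where b: "b = Suc b'" "q \<le> b'" by (cases b) auto
      then have "x = h + b'" "R' = [i..<i + a] @ [h + q..<h + b']"
        using append(1) by auto
      then show ?thesis using snoc.IH[of a q b'] append(2) snoc.prems b by (auto simp: opn_snoc Suc_diff_le)
    next
      case False
      then have qb: "q = b" using snoc.prems by simp
      then obtain a' where a: "a = Suc a'" "x = i + a'" "R' = [i..<i + a']"
        using append(1) upt_eq_snocD[of i a R' x] by auto
      then show ?thesis using snoc.IH[of a' b b] append(2) snoc.prems qb by (auto simp: opn_snoc)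
    qed
  next
    case (bump xs y ys C')
    obtain q' where q: "q = Suc q'" "y = h + q'" "C' = [h..<h + q']"
      using bump(2) upt_eq_snocD[of h q C' y] by auto
    have srt: "sorted (xs @ y # ys)" using bump(4) T(2) by (auto simp: two_rows_def)
    have R: "set [i..<i + a] \<subseteq> {..<h}" "set [h + q..<h + b] \<subseteq> {h + q..}"
      using snoc.prems by auto
    have "set (xs @ x # ys) \<subseteq> {..<h} \<union> {h + q..}"
      using R unfolding bump(1)[symmetric] set_append by blast
    then have sub: "set xs \<subseteq> {..<h} \<union> {h + q..}" "x \<in> {..<h} \<union> {h + q..}" "set ys \<subseteq> {..<h} \<union> {h + q..}"
      by auto
    have A: "filter (\<lambda>z. z < h) ([i..<i + a] @ [h + q..<h + b]) = [i..<i + a]"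
      using R snoc.prems(2) by (auto simp: filter_id_conv filter_empty_conv)
    have B: "filter (\<lambda>z. \<not> z < h) ([i..<i + a] @ [h + q..<h + b]) = [h + q..<h + b]"
      using R snoc.prems(2) by (auto simp: filter_id_conv filter_empty_conv)
    \<comment> \<open>Every entry of the bottom row is below \<open>h\<close> or at least
      \<open>h + q\<close>; as \<open>x\<close> is smaller than the bumped letter
      \<open>h + q'\<close> and \<open>q = Suc q'\<close>, it is a lower letter.\<close>
    have x: "x < h" using sub(2) bump(3) q by auto
    have xs: "z < h" if "z \<in> set xs" for z using that srt sub(1) q by (auto simp: sorted_append dest!: bspec subsetD)
    have ys: "\<not> z < h" if "z \<in> set ys" for z using that srt q by (auto simp: sorted_append dest!: bspec)
    have "[i..<i + a] = xs @ [x]" and ys': "[h + q..<h + b] = ys"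
      using A B x xs ys unfolding bump(1) by (simp_all add: filter_id_conv[THEN iffD2] filter_empty_conv[THEN iffD2])
    then obtain a' where a: "a = Suc a'" "x = i + a'" "xs = [i..<i + a']"
      using upt_eq_snocD[of i a xs x] by auto
    have "q' < b" using q snoc.prems by simp
    then have "xs @ y # ys = [i..<i + a'] @ [h + q'..<h + b]"
      using a q ys' by (simp add: upt_conv_Cons)
    then show ?thesis using snoc.IH[of a' q' b] bump(4) snoc.prems q a by (auto simp: opn_snoc)
  qed
qed

text \<open>Forward insertion keeps exactly the last \<open>c\<close> upper letters in the bottom
  row. The bound \<open>c \<le> b\<close> is carried along because it gives the truncated difference
  \<open>b - c\<close> its meaning.\<close>

lemma two_rows_insertionI:
  assumes "filter (\<lambda>x. x < h) u = [i..<i + a]" "filter (\<lambda>x. h \<le> x) u = [h..<h + b]" "i + a \<le> h"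
    and "c = opn (\<lambda>x. x < h) (\<lambda>x. h \<le> x) 0 u"
  shows "c \<le> b \<and> two_rows (insertion_tableau u) ([i..<i + a] @ [h + (b - c)..<h + b]) [h..<h + (b - c)]"
  using assms
proof (induction u arbitrary: a b c rule: rev_induct)
  case Nil
  then show ?case by (auto simp: two_rows_def insertion_tableau_def opn_def)
next
  case (snoc x u)
  let ?T = "insertion_tableau u"
  define c' where "c' = opn (\<lambda>x. x < h) (\<lambda>x. h \<le> x) 0 u"
  show ?case
  proof (cases "x < h")
    case True
    then obtain a' where a: "a = Suc a'" "x = i + a'" "filter (\<lambda>x. x < h) u = [i..<i + a']"
      using snoc.prems(1) upt_eq_snocD[of i a "filter (\<lambda>x. x < h) u" x] by auto
    have IH: "c' \<le> b" "two_rows ?T ([i..<i + a'] @ [h + (b - c')..<h + b]) [h..<h + (b - c')]"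
      using snoc.IH[of a' b c'] a snoc.prems True c'_def by auto
    have c: "c = c' - 1" using snoc.prems(4) True by (simp add: opn_snoc c'_def)
    show ?thesis
    proof (cases "c' = 0")
      case True
      then show ?thesis
        using IH c a two_rows_append[OF IH(2), of x] by (simp add: insertion_tableau_snoc)
    next
      case False
      then have "[h + (b - c')..<h + b] = (h + (b - c')) # [h + (b - c)..<h + b]"
        using IH(1) c by (simp add: upt_conv_Cons Suc_diff_le[symmetric])
      moreover have "[h..<h + (b - c)] = [h..<h + (b - c')] @ [h + (b - c')]"
      proof -
        have "h + (b - c) = Suc (h + (b - c'))" using IH(1) c False by simp
        then show ?thesis by simp
      qed
      ultimately show ?thesis
        using two_rows_bump[of ?T "[i..<i + a']" "h + (b - c')" "[h + (b - c)..<h + b]" "[h..<h + (b - c')]" x]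
          IH c a True by (simp add: insertion_tableau_snoc)
    qed
  next
    case False
    then obtain b' where b: "b = Suc b'" "x = h + b'" "filter (\<lambda>x. h \<le> x) u = [h..<h + b']"
      using snoc.prems(2) upt_eq_snocD[of h b "filter (\<lambda>x. h \<le> x) u" x] by auto
    have IH: "c' \<le> b'" "two_rows ?T ([i..<i + a] @ [h + (b' - c')..<h + b']) [h..<h + (b' - c')]"
      using snoc.IH[of a b' c'] b snoc.prems False c'_def by auto
    have c: "c = Suc c'" using snoc.prems(4) False by (simp add: opn_snoc c'_def)
    have "\<forall>y\<in>set ([i..<i + a] @ [h + (b' - c')..<h + b']). y \<le> x"
      using b(2) snoc.prems(3) by auto
    from two_rows_append[OF IH(2) this] show ?thesis
      using b c IH(1) by (simp add: insertion_tableau_snoc)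
  qed
qed

text \<open>The prescribed tableau is the case of the two-row description in which no upper letter
  is left in the bottom row, that is, no bracket stays open.\<close>

lemma dyck_interval_iff:
  "dyck_interval t i m \<longleftrightarrow> 1 \<le> m \<and> 1 \<le> i \<and> i + 2 * m \<le> length t
    \<and> filter (\<lambda>x. i \<le> x \<and> x \<le> i + m) t = [i..<i + m + 1]
    \<and> filter (\<lambda>x. i + m < x \<and> x \<le> i + 2 * m) t = [i + m + 1..<i + 2 * m + 1]
    \<and> suffix_dom (\<lambda>x. i \<le> x \<and> x \<le> i + m) (\<lambda>x. i + m < x \<and> x \<le> i + 2 * m) t"
proof (cases "1 \<le> m \<and> 1 \<le> i \<and> i + 2 * m \<le> length t")
  case True
  let ?P = "\<lambda>x. i \<le> x \<and> x \<le> i + m" and ?Q = "\<lambda>x. i + m < x \<and> x \<le> i + 2 * m"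
  define h where "h = i + m + 1"
  define u where "u = filter (\<lambda>x. i \<le> x \<and> x \<le> i + 2 * m) t"
  have P: "filter (\<lambda>x. x < h) u = filter ?P t" and Q: "filter (\<lambda>x. h \<le> x) u = filter ?Q t"
    unfolding u_def h_def by (auto intro!: filter_cong)
  have o: "opn (\<lambda>x. x < h) (\<lambda>x. h \<le> x) 0 u = 0 \<longleftrightarrow> suffix_dom ?P ?Q t"
  proof -
    have "opn (\<lambda>x. x < h) (\<lambda>x. h \<le> x) 0 u = opn ?P ?Q 0 u"
      unfolding opn_def by (rule foldl_cong) (auto simp: u_def h_def)
    also have "\<dots> = opn ?P ?Q 0 t" unfolding u_def by (rule opn_filter) auto
    finally show ?thesis using opn_eq_0_iff[of ?P ?Q t] by auto
  qed
  have "insertion_tableau u = [[i..<i + m + 1], [i + m + 1..<i + 2 * m + 1]] \<longleftrightarrow>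
      two_rows (insertion_tableau u) ([i..<i + (m + 1)] @ [h + m..<h + m]) [h..<h + m]"
    using True by (auto simp: two_rows_def h_def mult_2 add.assoc)
  also have "\<dots> \<longleftrightarrow> filter (\<lambda>x. x < h) u = [i..<i + (m + 1)] \<and> filter (\<lambda>x. h \<le> x) u = [h..<h + m]
      \<and> opn (\<lambda>x. x < h) (\<lambda>x. h \<le> x) 0 u = 0"
    using two_rows_insertionD[of u i "m + 1" h m m] two_rows_insertionI[of h u i "m + 1" m 0]
    by (auto simp: h_def)
  also have "\<dots> \<longleftrightarrow> filter ?P t = [i..<i + m + 1] \<and> filter ?Q t = [i + m + 1..<i + 2 * m + 1]
    \<and> suffix_dom ?P ?Q t"
    unfolding P Q o by (simp add: h_def mult_2 add.assoc)
  finally show ?thesis using True by (simp add: dyck_interval_def u_def)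
qed (auto simp: dyck_interval_def)

subsection \<open>Tableaux and the bijection on vertices\<close>

text \<open>Position of a cell in the reading word, which begins with the rows above row
  \<open>r\<close>; hence the sum over \<open>drop (Suc r) sh\<close>.\<close>

definition cell_index :: "nat list \<Rightarrow> nat \<Rightarrow> nat \<Rightarrow> nat" where
  "cell_index sh r c = sum_list (drop (Suc r) sh) + c"

lemma shape_Cons: "shape (r # T) = length r # shape T"
  by (simp add: shape_def)

lemma row_Cons: "row (r # T) = row T @ r"
  by (simp add: row_def)

lemma length_row: "length (row T) = sum_list (shape T)"
  by (induction T) (simp_all add: row_def shape_def)

lemma length_concat_shape: "length (concat T) = sum_list (shape T)"
  by (simp add: shape_def length_concat)

lemma set_row: "set (row T) = set (concat T)"
  by (simp add: row_def)

lemma length_shape [simp]: "length (shape T) = length T"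
  by (simp add: shape_def)

lemma nth_shape: "r < length T \<Longrightarrow> shape T ! r = length (T ! r)"
  by (simp add: shape_def)

lemma row_cell_index:
  assumes "r < length T" "c < length (T ! r)"
  shows "cell_index (shape T) r c < length (row T)" "row T ! cell_index (shape T) r c = T ! r ! c"
proof -
  have "cell_index (shape T) r c < length (row T) \<and> row T ! cell_index (shape T) r c = T ! r ! c"
    using assms
  proof (induction T arbitrary: r)
    case (Cons a T)
    show ?case
    proof (cases r)
      case 0
      then show ?thesis
        using Cons.prems by (simp add: cell_index_def shape_Cons row_Cons length_row nth_append)
    next
      case (Suc r')
      then have "cell_index (shape (a # T)) r c = cell_index (shape T) r' c"
        by (simp add: cell_index_def shape_Cons)
      then show ?thesis using Cons.IH[of r'] Cons.prems Suc by (simp add: row_Cons nth_append)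
    qed
  qed simp
  then show "cell_index (shape T) r c < length (row T)" "row T ! cell_index (shape T) r c = T ! r ! c"
    by auto
qed

lemma cell_index_surj:
  assumes "p < length (row T)"
  obtains r c where "r < length T" "c < length (T ! r)" "p = cell_index (shape T) r c"
proof -
  have "\<exists>r c. r < length T \<and> c < length (T ! r) \<and> p = cell_index (shape T) r c"
    using assms
  proof (induction T)
    case (Cons a T)
    show ?case
    proof (cases "p < length (row T)")
      case True
      then obtain r c where "r < length T" "c < length (T ! r)" "p = cell_index (shape T) r c"
        using Cons.IH by blast
      then show ?thesis
        by (intro exI[of _ "Suc r"] exI[of _ c]) (simp add: cell_index_def shape_Cons)
    next
      case False
      then show ?thesis using Cons.prems
        by (intro exI[of _ 0] exI[of _ "p - length (row T)"])
          (auto simp: cell_index_def shape_Cons row_Cons length_row)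
    qed
  qed (simp add: row_def)
  then show ?thesis using that by blast
qed

lemma cell_index_less:
  assumes "r < r'" "r' < length sh" "c' < sh ! r'"
  shows "cell_index sh r' c' < cell_index sh r c"
proof -
  have "sum_list (drop (Suc r) sh) \<ge> sum_list (drop r' sh)"
  proof -
    have "drop (Suc r) sh = take (r' - Suc r) (drop (Suc r) sh) @ drop r' sh"
      using assms by (metis Suc_leI append_take_drop_id drop_drop le_add_diff_inverse2)
    then show ?thesis by (metis sum_list_append le_add2)
  qed
  moreover have "sum_list (drop r' sh) = sh ! r' + sum_list (drop (Suc r') sh)"
    using assms by (simp add: Cons_nth_drop_Suc[symmetric])
  ultimately show ?thesis using assms by (simp add: cell_index_def)
qed

section \<open>A tableau is determined by its shape and its reading word\<close>

lemma split_lens_concat: "split_lens (map length Ts) (concat Ts) = Ts"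
  by (induction Ts) auto

lemma concat_split_lens: "length w = sum_list ks \<Longrightarrow> concat (split_lens ks w) = w"
  by (induction ks arbitrary: w) auto

lemma map_length_split_lens: "length w = sum_list ks \<Longrightarrow> map length (split_lens ks w) = ks"
  by (induction ks arbitrary: w) auto

lemma unrow_row: "unrow (shape T) (row T) = T"
  unfolding unrow_def row_def shape_def by (metis rev_map rev_rev_ident split_lens_concat)

lemma row_unrow: "length w = sum_list sh \<Longrightarrow> row (unrow sh w) = w"
  by (simp add: row_def unrow_def concat_split_lens sum_list_rev)

lemma shape_unrow: "length w = sum_list sh \<Longrightarrow> shape (unrow sh w) = sh"
  by (simp add: shape_def unrow_def map_length_split_lens sum_list_rev flip: rev_map)

lemma row_eqD: "shape T = shape T' \<Longrightarrow> row T = row T' \<Longrightarrow> T = T'"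
  by (metis unrow_row)

lemma row_map_map: "row (map (map f) T) = map f (row T)"
  by (simp add: row_def map_concat rev_map)

lemma shape_map_map: "shape (map (map f) T) = shape T"
  by (simp add: shape_def)

lemma row_std: "row (std c) = std_word (row c)"
  by (simp add: std_def row_unrow length_row)

lemma shape_std: "shape (std c) = shape c"
  by (simp add: std_def shape_unrow length_row)

lemma f_tab_row: "f_tab j b = Some b' \<longleftrightarrow> shape b' = shape b \<and> f_word j (row b) = Some (row b')"
proof -
  have len: "length w = sum_list (shape b)" if "f_word j (row b) = Some w" for w
    using that by (auto simp: f_word_def Let_def length_row split: if_splits)
  show ?thesis
    using row_unrow[OF len] shape_unrow[OF len] unrow_row[of b']
    by (auto simp: f_tab_def)
qed

lemma SYT_perm:
  assumes "T \<in> SYT lam"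
  shows "is_perm (row T)"
proof -
  have T: "shape T = lam" "distinct (concat T)" "set (concat T) = {1..sum_list lam}"
    using assms by (auto simp: SYT_def)
  have "card (set (row T)) = length (row T)"
    using T by (simp add: set_row length_row)
  then show ?thesis using T unfolding is_perm_def by (simp add: card_distinct set_row length_row)
qed

lemma cell_index_inj:
  assumes "r < length sh" "c < sh ! r" "r' < length sh" "c' < sh ! r'"
    "cell_index sh r c = cell_index sh r' c'"
  shows "r = r' \<and> c = c'"
  using assms cell_index_less[of r r' sh c' c] cell_index_less[of r' r sh c c']
  by (cases r r' rule: linorder_cases) (auto simp: cell_index_def)

lemma row_of_eq:
  assumes "is_perm (row T)" "r < length T" "c < length (T ! r)"
  shows "row_of T (T ! r ! c) = r"
  unfolding row_of_def
proof (rule the_equality)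
  fix r' assume r': "r' < length T \<and> T ! r ! c \<in> set (T ! r')"
  then obtain c' where c': "c' < length (T ! r')" "T ! r' ! c' = T ! r ! c" by (metis in_set_conv_nth)
  have "cell_index (shape T) r' c' = cell_index (shape T) r c"
    using assms r' c' row_cell_index[of r' T c'] row_cell_index[of r T c]
    by (metis is_perm_def nth_eq_iff_index_eq)
  then show "r' = r" using cell_index_inj[of r' "shape T" c' r c] assms r' c' by (simp add: nth_shape)
qed (use assms in simp)

text \<open>Higher rows are read earlier, and inside a row \<open>d\<close> stands to the left of
  \<open>d + 1\<close>; so \<open>d + 1\<close> lies strictly higher exactly when it is read before
  \<open>d\<close>.\<close>

lemma descents_eq_wdes:
  assumes "T \<in> SYT lam"
  shows "descents T = wdes (row T)"
proof -
  have perm: "is_perm (row T)" using SYT_perm[OF assms] .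
  have srt: "\<forall>r\<in>set T. sorted_wrt (<) r" using assms by (simp add: SYT_def)
  have len: "length (concat T) = length (row T)" by (simp add: length_concat_shape length_row)
  have "d \<in> descents T \<longleftrightarrow> d \<in> wdes (row T)" if d: "1 \<le> d" "d < length (row T)" for d
  proof -
    have "d \<in> set (row T)" "Suc d \<in> set (row T)" using perm d by (auto simp: is_perm_def)
    then obtain p q where pq: "p < length (row T)" "row T ! p = d" "q < length (row T)" "row T ! q = Suc d"
      by (metis in_set_conv_nth)
    obtain r c where rc: "r < length T" "c < length (T ! r)" "p = cell_index (shape T) r c"
      using cell_index_surj[OF pq(1)] .
    obtain r' c' where rc': "r' < length T" "c' < length (T ! r')" "q = cell_index (shape T) r' c'"
      using cell_index_surj[OF pq(3)] .
    have v: "T ! r ! c = d" "T ! r' ! c' = Suc d" using row_cell_index rc rc' pq by auto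
    then have ro: "row_of T d = r" "row_of T (Suc d) = r'"
      using row_of_eq[OF perm rc(1,2)] row_of_eq[OF perm rc'(1,2)] by auto
    have "r < r' \<longleftrightarrow> q < p"
    proof (cases r r' rule: linorder_cases)
      case less
      then show ?thesis using cell_index_less[of r r' "shape T" c' c] rc rc' by (simp add: nth_shape)
    next
      case equal
      have "c < c'"
      proof (rule ccontr)
        assume "\<not> c < c'"
        moreover have "c \<noteq> c'" using v equal by auto
        ultimately have "T ! r ! c' < T ! r ! c"
          using srt rc equal by (intro sorted_wrt_nth_less[where P="(<)"]) auto
        then show False using v equal by simp
      qed
      then show ?thesis using equal rc rc' by (simp add: cell_index_def)
    next
      case greater
      then show ?thesis using cell_index_less[of r' r "shape T" c c'] rc rc' by (simp add: nth_shape)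
    qed
    moreover have "d \<in> descents T \<longleftrightarrow> r < r'"
      using d ro len by (simp add: descents_def)
    moreover have "d \<in> wdes (row T) \<longleftrightarrow> q < p"
    proof
      assume "d \<in> wdes (row T)"
      then obtain q' p' where *: "q' < p'" "p' < length (row T)" "row T ! q' = Suc d" "row T ! p' = d"
        by (auto simp: wdes_def)
      then have "q' = q" "p' = p" using perm pq by (metis is_perm_def nth_eq_iff_index_eq order.strict_trans)+
      then show "q < p" using * by simp
    qed (use pq in \<open>auto simp: wdes_def\<close>)
    ultimately show ?thesis by blast
  qed
  moreover have "descents T \<subseteq> {1..<length (row T)}" using len by (auto simp: descents_def)
  ultimately show ?thesis using wdes_subset[OF perm]
    by (metis (no_types, lifting) atLeastLessThan_iff subsetI subset_antisym subset_eq)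
qed

section \<open>Blocks of the descent composition and the vertex map\<close>

lemma sorted_nth_less_iff:
  assumes "sorted_wrt (<) xs" "k < length xs"
  shows "xs ! k < (x :: nat) \<longleftrightarrow> k < card {d \<in> set xs. d < x}"
proof -
  have mono: "a \<le> b \<Longrightarrow> b < length xs \<Longrightarrow> xs ! a \<le> xs ! b" for a b
    using assms(1) by (metis le_less sorted_wrt_nth_less)
  have "card {d \<in> set xs. d < x} = card {a. a < length xs \<and> xs ! a < x}"
  proof -
    have "distinct xs" using assms(1) strict_sorted_iff by blast
    then have "card ((!) xs ` {a. a < length xs \<and> xs ! a < x}) = card {a. a < length xs \<and> xs ! a < x}"
      by (intro card_image) (auto simp: inj_on_def nth_eq_iff_index_eq)
    moreover have "(!) xs ` {a. a < length xs \<and> xs ! a < x} = {d \<in> set xs. d < x}"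
      by (auto simp: set_conv_nth)
    ultimately show ?thesis by simp
  qed
  moreover have "k < card {a. a < length xs \<and> xs ! a < x}" if "xs ! k < x"
  proof -
    have "{..k} \<subseteq> {a. a < length xs \<and> xs ! a < x}"
    proof
      fix a assume "a \<in> {..k}"
      then show "a \<in> {a. a < length xs \<and> xs ! a < x}" using mono[of a k] that assms(2) by simp
    qed
    then have "card {..k} \<le> card {a. a < length xs \<and> xs ! a < x}" by (intro card_mono) auto
    then show ?thesis by simp
  qed
  moreover have "card {a. a < length xs \<and> xs ! a < x} \<le> k" if "\<not> xs ! k < x"
  proof -
    have "{a. a < length xs \<and> xs ! a < x} \<subseteq> {..<k}"
    proof
      fix a assume "a \<in> {a. a < length xs \<and> xs ! a < x}"
      then show "a \<in> {..<k}" using mono[of k a] that by (cases "k \<le> a") auto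
    qed
    then have "card {a. a < length xs \<and> xs ! a < x} \<le> card {..<k}" by (intro card_mono) auto
    then show ?thesis by simp
  qed
  ultimately show ?thesis by linarith
qed

lemma sum_list_take_diffs:
  assumes "sorted s" "k < length s"
  shows "sum_list (take k (map (\<lambda>k. s ! Suc k - s ! k) [0..<length s - 1])) = s ! k - (s ! 0 :: nat)"
  using assms(2)
proof (induction k)
  case (Suc k)
  have "s ! 0 \<le> s ! k" "s ! k \<le> s ! Suc k" using assms(1) Suc.prems by (auto intro: sorted_nth_mono)
  moreover have "[0..<length s - 1] ! k = k" using Suc.prems by (subst nth_upt) auto
  ultimately show ?case using Suc by (simp add: take_Suc_conv_app_nth)
qed simp

context
  fixes T lam
  assumes T: "T \<in> SYT lam" and ne: "0 < sum_list lam"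
begin

lemma length_row_SYT: "length (row T) = sum_list lam"
  using T by (simp add: length_row SYT_def)

lemma length_Des: "length (Des T) = Suc (card (wdes (row T)))"
  by (simp add: Des_def Let_def descents_eq_wdes[OF T])

text \<open>The partial sums of the descent composition telescope to the descents, with 0 and N
  added at the ends. If \<open>k\<close> descents lie below \<open>x\<close>, the two bounds of
  block \<open>j\<close> say \<open>j - 1 \<le> k\<close> and \<open>k \<le> j - 1\<close>, and
  \<open>k + 1\<close> is the level of \<open>x\<close>.\<close>

lemma block_Des_iff:
  assumes "1 \<le> j" "j \<le> length (Des T)" "x \<in> {1..sum_list lam}"
  shows "x \<in> block (Des T) j \<longleftrightarrow> lvl (row T) x = j"
proof -
  define N where "N = sum_list lam"
  define S where "S = wdes (row T)"
  define xs where "xs = sorted_list_of_set S"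
  define s where "s = 0 # xs @ [N]"
  have perm: "is_perm (row T)" by (rule SYT_perm[OF T])
  have S: "S \<subseteq> {1..<N}" "finite S"
    using wdes_subset[OF perm] finite_wdes[OF perm] length_row_SYT by (auto simp: S_def N_def)
  have xs: "sorted_wrt (<) xs" "set xs = S" "length xs = card S"
    using S by (auto simp: xs_def)
  have s: "sorted s"
    using xs S by (auto simp: s_def sorted_append strict_sorted_imp_sorted less_imp_le)
  have "length (concat T) = N" using length_row_SYT by (simp add: length_concat_shape length_row N_def)
  then have Des: "Des T = map (\<lambda>k. s ! Suc k - s ! k) [0..<length s - 1]"
    by (simp add: Des_def Let_def descents_eq_wdes[OF T] s_def xs_def S_def)
  have j: "j \<le> Suc (length xs)" using assms length_Des xs by (simp add: S_def)
  have sums: "sum_list (take k (Des T)) = s ! k" if "k \<le> Suc (length xs)" for k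
    unfolding Des using sum_list_take_diffs[OF s, of k] that by (simp add: s_def)
  define k where "k = card {d \<in> S. d < x}"
  have k: "k \<le> length xs" unfolding k_def xs(3) using S by (intro card_mono) auto
  have xsk: "xs ! a < x \<longleftrightarrow> a < k" if "a < length xs" for a
    using sorted_nth_less_iff[OF xs(1) that, of x] xs(2) by (simp add: k_def)
  have 1: "s ! (j - 1) < x \<longleftrightarrow> j - 1 \<le> k"
  proof (cases "j - 1")
    case 0
    then show ?thesis using assms by (simp add: s_def)
  next
    case (Suc n)
    then show ?thesis using xsk[of n] j by (auto simp: s_def nth_append)
  qed
  have 2: "x \<le> s ! j \<longleftrightarrow> k \<le> j - 1"
  proof (cases "j = Suc (length xs)")
    case True
    then show ?thesis using assms k by (simp add: s_def nth_append N_def)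
  next
    case False
    then obtain j' where "j = Suc j'" "j' < length xs" using j assms by (cases j) auto
    then show ?thesis using xsk[of j'] by (auto simp: s_def nth_append)
  qed
  have "x \<in> block (Des T) j \<longleftrightarrow> s ! (j - 1) < x \<and> x \<le> s ! j"
    using sums[of "j - 1"] sums[of j] j by (auto simp: block_def)
  also have "\<dots> \<longleftrightarrow> lvl (row T) x = j"
    using assms(1) unfolding 1 2 by (auto simp: lvl_def k_def S_def)
  finally show ?thesis .
qed

lemma destd_eq: "destd T = map (map (lvl (row T))) T"
  unfolding destd_def Let_def
proof (intro map_cong refl)
  fix r x assume "r \<in> set T" "x \<in> set r"
  then have x: "x \<in> {1..sum_list lam}" using T by (auto simp: SYT_def)
  have perm: "is_perm (row T)" by (rule SYT_perm[OF T])
  show "(THE j. 1 \<le> j \<and> j \<le> length (Des T) \<and> x \<in> block (Des T) j) = lvl (row T) x"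
    using block_Des_iff[OF _ _ x] lvl_pos[of "row T" x] lvl_le[OF perm, of x] length_Des
    by (intro the_equality) auto
qed

lemma row_destd: "row (destd T) = map (lvl (row T)) (row T)"
  by (simp add: destd_eq row_map_map)

lemma shape_destd: "shape (destd T) = lam"
  using T by (simp add: destd_eq shape_map_map SYT_def)

lemma std_destd: "std (destd T) = T"
  using T by (intro row_eqD)
    (simp_all add: shape_std shape_destd row_std row_destd std_word_map_lvl SYT_perm[OF T] SYT_def)

text \<open>Rows stay weakly increasing since levels are monotone. Columns stay strict because the
  upper of two adjacent cells is read earlier although its value is larger, which
  \<open>lvl_eq_order\<close> excludes for equal levels.\<close>

lemma destd_SSYT: "destd T \<in> SSYT lam (length (Des T))"
proof -
  have perm: "is_perm (row T)" by (rule SYT_perm[OF T])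
  have cs: "cols_strict T" and srt: "\<forall>r\<in>set T. sorted_wrt (<) r" using T by (auto simp: SYT_def)
  have "sorted r" if r: "r \<in> set (destd T)" for r
  proof -
    obtain r' where r': "r' \<in> set T" "r = map (lvl (row T)) r'" using r by (auto simp: destd_eq)
    then have "sorted_wrt (<) r'" using srt by simp
    then show ?thesis unfolding r'(2) sorted_map
      by (rule sorted_wrt_mono_rel[rotated]) (simp add: lvl_mono[OF perm])
  qed
  moreover have "cols_strict (destd T)"
    unfolding cols_strict_def
  proof (intro allI impI)
    fix r c assume "Suc r < length (destd T) \<and> c < length (destd T ! Suc r)"
    then have rc: "Suc r < length T" "c < length (T ! Suc r)" by (auto simp: destd_eq)
    then have rc': "c < length (T ! r)" "T ! r ! c < T ! Suc r ! c" using cs by (auto simp: cols_strict_def)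
    have "lvl (row T) (T ! r ! c) \<noteq> lvl (row T) (T ! Suc r ! c)"
    proof
      assume "lvl (row T) (T ! r ! c) = lvl (row T) (T ! Suc r ! c)"
      then have "cell_index (shape T) r c < cell_index (shape T) (Suc r) c"
        using lvl_eq_order[OF perm, of "cell_index (shape T) r c" "cell_index (shape T) (Suc r) c"]
          row_cell_index[of r T c] row_cell_index[of "Suc r" T c] rc rc' by simp
      then show False using cell_index_less[of r "Suc r" "shape T" c c] rc by (simp add: nth_shape)
    qed
    then have "lvl (row T) (T ! r ! c) < lvl (row T) (T ! Suc r ! c)"
      using lvl_mono[OF perm, of "T ! r ! c" "T ! Suc r ! c"] rc' by simp
    then show "c < length (destd T ! r) \<and> destd T ! r ! c < destd T ! Suc r ! c"
      using rc rc' by (simp add: destd_eq)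
  qed
  moreover have "set (concat (destd T)) \<subseteq> {1..length (Des T)}"
    using lvl_pos[of "row T"] lvl_le[OF perm]
    by (auto simp: set_row[symmetric] row_destd length_Des simp del: set_concat)
  ultimately show ?thesis by (auto simp: SSYT_def shape_destd)
qed

lemma weight_destd: "weight (length (Des T)) (destd T) = Des T"
proof (rule nth_equalityI)
  fix k assume "k < length (weight (length (Des T)) (destd T))"
  then have k: "k < length (Des T)" by (simp add: weight_def del: upt_Suc)
  have perm: "is_perm (row T)" by (rule SYT_perm[OF T])
  have N: "length (row T) = sum_list lam" by (rule length_row_SYT)
  have "weight (length (Des T)) (destd T) ! k = count_list (map (lvl (row T)) (row T)) (Suc k)"
    using k by (simp add: weight_def row_destd del: upt_Suc)
  also have "\<dots> = length (filter (\<lambda>x. lvl (row T) x = Suc k) (row T))"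
    by (simp add: count_list_eq_length_filter filter_map o_def eq_commute)
  also have "\<dots> = card {x \<in> set (row T). lvl (row T) x = Suc k}"
    using perm by (subst distinct_card[symmetric]) (auto simp: is_perm_def)
  also have "{x \<in> set (row T). lvl (row T) x = Suc k} = block (Des T) (Suc k)"
  proof -
    \<comment> \<open>The parts telescope to the size of the shape, so the block contains only
      values that occur in \<open>T\<close>.\<close>
    have "block (Des T) (Suc k) \<subseteq> {1..sum_list lam}"
    proof -
      have "sum_list (take (Suc k) (Des T)) \<le> sum_list (Des T)"
        by (metis append_take_drop_id le_add1 sum_list_append)
      moreover have "sum_list (Des T) = sum_list lam"
      proof -
        have "Des T = map (\<lambda>k. (0 # sorted_list_of_set (wdes (row T)) @ [sum_list lam]) ! Suc k
            - (0 # sorted_list_of_set (wdes (row T)) @ [sum_list lam]) ! k)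
            [0..<length (0 # sorted_list_of_set (wdes (row T)) @ [sum_list lam]) - 1]"
          using length_row_SYT
          by (simp add: Des_def Let_def descents_eq_wdes[OF T] length_concat_shape length_row)
        moreover have "sorted (0 # sorted_list_of_set (wdes (row T)) @ [sum_list lam])"
          using wdes_subset[OF perm] finite_wdes[OF perm] N by (auto simp: sorted_append)
        ultimately show ?thesis
          using sum_list_take_diffs[of "0 # sorted_list_of_set (wdes (row T)) @ [sum_list lam]"
              "Suc (length (sorted_list_of_set (wdes (row T))))"]
          by (simp add: nth_append)
      qed
      ultimately show ?thesis by (auto simp: block_def)
    qed
    moreover have "set (row T) = {1..sum_list lam}" using perm N by (simp add: is_perm_def)
    ultimately show ?thesis using block_Des_iff[of "Suc k"] k by auto
  qed
  also have "card (block (Des T) (Suc k)) = Des T ! k"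
    using k by (simp add: block_def take_Suc_conv_app_nth)
  finally show "weight (length (Des T)) (destd T) ! k = Des T ! k" .
qed (simp add: weight_def del: upt_Suc)

end

section \<open>Standardization back to standard tableaux, and the first column\<close>

lemma std_SYT:
  assumes "b \<in> SSYT lam n"
  shows "std b \<in> SYT lam"
proof -
  define T where "T = std b"
  have b: "shape b = lam" "\<forall>r\<in>set b. sorted r" "cols_strict b" using assms by (auto simp: SSYT_def)
  have shT: "shape T = shape b" by (simp add: T_def shape_std)
  then have lenT: "length T = length b" by (metis length_shape)
  have lenr: "length (T ! r) = length (b ! r)" if "r < length b" for r
    using that shT lenT nth_shape[of r T] nth_shape[of r b] by simp
  have perm: "is_perm (row T)" by (simp add: T_def row_std is_perm_std_word)
  have less: "T ! r ! c < T ! r' ! c'"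
    if "r < length b" "c < length (b ! r)" "r' < length b" "c' < length (b ! r')"
      "b ! r ! c < b ! r' ! c' \<or> b ! r ! c = b ! r' ! c' \<and> cell_index (shape b) r c < cell_index (shape b) r' c'"
    for r c r' c'
  proof -
    have "wless (row b) (cell_index (shape b) r c) (cell_index (shape b) r' c')"
      using that by (simp add: wless_def row_cell_index)
    then have "row T ! cell_index (shape b) r c < row T ! cell_index (shape b) r' c'"
      using that by (simp add: T_def row_std std_word_less_iff row_cell_index)
    then show ?thesis
      using that row_cell_index(2)[of r T c] row_cell_index(2)[of r' T c'] lenT lenr shT by simp
  qed
  have "sorted_wrt (<) x" if x: "x \<in> set T" for x
  proof -
    obtain r where r: "r < length b" "x = T ! r" using x lenT by (metis in_set_conv_nth)
    show ?thesis unfolding sorted_wrt_iff_nth_less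
    proof (intro allI impI)
      fix c c' assume c: "c < c'" "c' < length x"
      then have "b ! r ! c \<le> b ! r ! c'" using b r lenr by (intro sorted_nth_mono) auto
      \<comment> \<open>Equal entries of a row are read from left to right, so standardization
        separates them in increasing order.\<close>
      then show "x ! c < x ! c'" using less[of r c r c'] c r lenr by (auto simp: cell_index_def le_less)
    qed
  qed
  moreover have "cols_strict T"
    using b(3) less lenT lenr unfolding cols_strict_def by (metis Suc_lessD)
  moreover have "set (concat T) = {1..sum_list lam}"
    using perm shT b(1) by (simp add: is_perm_def length_row set_row[symmetric] del: set_concat)
  moreover have "distinct (concat T)"
  proof (rule card_distinct)
    show "card (set (concat T)) = length (concat T)"
      using perm by (simp add: is_perm_def distinct_card length_concat_shape length_row[symmetric]
          set_row[symmetric] del: set_concat)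
  qed
  ultimately show ?thesis using shT b(1) by (simp add: SYT_def flip: T_def)
qed

text \<open>A strictly increasing column of l entries from 1, ..., l leaves one possibility;
  \<open>lo\<close> climbs from the bottom, \<open>hi\<close> descends from the top.\<close>

lemma SSYT_first_column:
  assumes "is_partition lam" "b \<in> SSYT lam (length lam)" "r < length lam"
  shows "0 < length (b ! r)" "b ! r ! 0 = Suc r"
proof -
  define l where "l = length lam"
  have b: "shape b = lam" "cols_strict b" "set (concat b) \<subseteq> {1..l}" using assms by (auto simp: SSYT_def l_def)
  have lenb: "length b = l" using b(1) by (metis length_shape l_def)
  have pos: "0 < length (b ! r)" if "r < l" for r
  proof -
    have "lam ! r \<in> set lam" using that by (simp add: l_def)
    then show ?thesis
      using assms(1) nth_shape[of r b] b(1) lenb that by (auto simp: is_partition_def)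
  qed
  have rng: "b ! r ! 0 \<in> {1..l}" if "r < l" for r
  proof -
    have "b ! r ! 0 \<in> set (b ! r)" "b ! r \<in> set b" using pos that lenb by auto
    then show ?thesis using b(3) by auto
  qed
  have up: "b ! r ! 0 < b ! Suc r ! 0" if "Suc r < l" for r
    using b(2) pos that lenb by (auto simp: cols_strict_def)
  have lo: "r < l \<Longrightarrow> Suc r \<le> b ! r ! 0" for r
  proof (induction r)
    case 0
    then show ?case using rng[of 0] by simp
  next
    case (Suc r)
    then show ?case using up[of r] by simp
  qed
  have hi: "k < l \<Longrightarrow> b ! (l - Suc k) ! 0 \<le> l - k" for k
  proof (induction k)
    case 0
    then show ?case using rng[of "l - 1"] by simp
  next
    case (Suc k)
    then have "Suc (l - Suc (Suc k)) = l - Suc k" by simp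
    then show ?case using up[of "l - Suc (Suc k)"] Suc by simp
  qed
  show "0 < length (b ! r)" using pos assms(3) l_def by simp
  show "b ! r ! 0 = Suc r" using lo[of r] hi[of "l - Suc r"] assms(3) l_def by simp
qed

text \<open>Row indices start at 0, so row \<open>r\<close> begins with \<open>r + 1\<close>. An
  entry \<open>j\<close> in row \<open>r\<close> thus has \<open>r < j\<close>, and row
  \<open>j\<close>, which begins with \<open>j + 1\<close>, lies strictly higher and is read before
  it.\<close>

lemma SSYT_preceded:
  assumes "is_partition lam" "b \<in> SSYT lam (length lam)" "p < length (row b)" "row b ! p < length lam"
  shows "\<exists>q<p. row b ! q = Suc (row b ! p)"
proof -
  have b: "shape b = lam" "\<forall>r\<in>set b. sorted r" using assms by (auto simp: SSYT_def)
  have lenb: "length b = length lam" using b(1) by (metis length_shape)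
  obtain r c where rc: "r < length b" "c < length (b ! r)" "p = cell_index (shape b) r c"
    using cell_index_surj[OF assms(3)] .
  then have v: "row b ! p = b ! r ! c" using row_cell_index by simp
  define j where "j = row b ! p"
  have "b ! r ! 0 \<le> b ! r ! c" using b rc by (intro sorted_nth_mono) auto
  then have "r < j" using SSYT_first_column[OF assms(1,2), of r] rc lenb v by (simp add: j_def)
  moreover have j: "j < length b" using assms(4) lenb by (simp add: j_def)
  moreover have c: "0 < length (b ! j)" "b ! j ! 0 = Suc j"
    using SSYT_first_column[OF assms(1,2), of j] j lenb by auto
  ultimately have "cell_index (shape b) j 0 < p"
    using cell_index_less[of r j "shape b" 0 c] rc by (simp add: nth_shape)
  then show ?thesis using row_cell_index[of j b 0] j c by (auto simp: j_def)
qed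

lemma SSYT_set_row:
  assumes "is_partition lam" "b \<in> SSYT lam (length lam)"
  shows "set (row b) = {1..length lam}"
proof
  show "set (row b) \<subseteq> {1..length lam}"
    using assms by (simp add: SSYT_def set_row del: set_concat)
  have lenb: "length b = length lam" using assms by (auto simp: SSYT_def simp flip: length_shape)
  show "{1..length lam} \<subseteq> set (row b)"
  proof
    fix x assume "x \<in> {1..length lam}"
    then obtain r where r: "x = Suc r" "r < length lam" by (cases x) auto
    then have "x = row b ! cell_index (shape b) r 0" "cell_index (shape b) r 0 < length (row b)"
      using SSYT_first_column[OF assms r(2)] row_cell_index[of r b 0] lenb by auto
    then show "x \<in> set (row b)" by simp
  qed
qed

lemma sum_list_partition_pos: "is_partition lam \<Longrightarrow> lam \<noteq> [] \<Longrightarrow> 0 < sum_list lam"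
  by (cases lam) (auto simp: is_partition_def)

lemma destd_std:
  assumes "is_partition lam" "lam \<noteq> []" "b \<in> SSYT lam (length lam)"
  shows "destd (std b) = b" "std b \<in> CS_vertices_l lam (length lam)"
proof -
  have pos: "0 < sum_list lam" using sum_list_partition_pos assms by simp
  have S: "std b \<in> SYT lam" using std_SYT assms by blast
  have l: "1 \<le> length lam" using assms(2) by (cases lam) auto
  have wk: "\<exists>q p. q < p \<and> p < length (row b) \<and> row b ! q = Suc j \<and> row b ! p = j"
    if "1 \<le> j" "j < length lam" for j
  proof -
    have "j \<in> set (row b)" using SSYT_set_row[OF assms(1,3)] that by simp
    then obtain p where p: "p < length (row b)" "row b ! p = j" by (metis in_set_conv_nth)
    then show ?thesis using SSYT_preceded[OF assms(1,3) p(1)] that by blast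
  qed
  note lv = lvl_std_word[OF SSYT_set_row[OF assms(1,3)] l wk row_std]
  show "destd (std b) = b"
    using lv(1) assms(3) by (intro row_eqD) (auto simp: shape_destd[OF S pos] row_destd[OF S pos] SSYT_def)
  show "std b \<in> CS_vertices_l lam (length lam)"
    using lv(2) S l by (simp add: CS_vertices_l_def length_Des[OF S pos])
qed

lemma bij_betw_destd:
  assumes "is_partition lam" "lam \<noteq> []"
  shows "bij_betw destd (CS_vertices_l lam (length lam)) (SSYT lam (length lam))"
proof (rule bij_betw_byWitness[where f' = std])
  have pos: "0 < sum_list lam" using sum_list_partition_pos assms by simp
  show "\<forall>T\<in>CS_vertices_l lam (length lam). std (destd T) = T"
    using std_destd pos by (auto simp: CS_vertices_l_def)
  show "destd ` CS_vertices_l lam (length lam) \<subseteq> SSYT lam (length lam)"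
    using destd_SSYT pos by (force simp: CS_vertices_l_def)
qed (use destd_std assms in auto)

subsection \<open>Edges in terms of words\<close>

definition merge_letter :: "nat \<Rightarrow> nat \<Rightarrow> nat \<Rightarrow> nat" where
  "merge_letter i m x = (if i \<le> x \<and> x \<le> i + m then i
      else if i + m < x \<and> x \<le> i + 2 * m then Suc i else x)"

abbreviation (input) lower :: "nat \<Rightarrow> nat \<Rightarrow> nat \<Rightarrow> bool" where
  "lower i m x \<equiv> i \<le> x \<and> x \<le> i + m"

abbreviation (input) upper :: "nat \<Rightarrow> nat \<Rightarrow> nat \<Rightarrow> bool" where
  "upper i m x \<equiv> i + m < x \<and> x \<le> i + 2 * m"

text \<open>Since \<open>m\<close> is positive, the letter \<open>i + 1\<close> itself lies in the
  lower half and is merged into \<open>i\<close>; so no letter outside the interval appears as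
  \<open>i + 1\<close>.\<close>

lemma merge_letter_eq_iff:
  assumes "1 \<le> m"
  shows "merge_letter i m x = i \<longleftrightarrow> lower i m x" "merge_letter i m x = Suc i \<longleftrightarrow> upper i m x"
  using assms by (auto simp: merge_letter_def)

lemma f_word_merge_iff:
  assumes "1 \<le> m"
  shows "f_word i (map (merge_letter i m) t) = Some w' \<longleftrightarrow> (\<exists>t1 x t2. t = t1 @ x # t2 \<and> lower i m x
     \<and> w' = map (merge_letter i m) t1 @ Suc i # map (merge_letter i m) t2
     \<and> suffix_dom (lower i m) (upper i m) t1 \<and> prefix_dom (lower i m) (upper i m) t2)"
  unfolding f_word_map_iff merge_letter_eq_iff[OF assms] ..

text \<open>With \<open>e = 1\<close> the letters above the interval are pushed up by one, which separates them
  from the new letter \<open>j + 1\<close>.\<close>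
lemma std_word_merge:
  assumes perm: "is_perm t" and t: "t = t1 @ x # t2"
    and m: "1 \<le> m" and x: "lower i m x"
    and lo: "\<And>y. lower i m y \<Longrightarrow> lvl t y = j"
    and up: "\<And>y. upper i m y \<Longrightarrow> lvl t y = Suc j"
    and G: "\<And>y. G y = lvl t y + (if i + 2 * m < y then e else 0)"
    and cond: "e = 0 \<Longrightarrow> \<forall>y\<in>set t1. lvl t y = Suc j \<longrightarrow> y \<le> i + 2 * m"
  shows "std_word (map (merge_letter i m) t1 @ Suc i # map (merge_letter i m) t2)
       = std_word (map G t1 @ Suc j # map G t2)"
proof (rule std_word_cong)
  let ?n = "length t1"
  let ?w = "map (merge_letter i m) t1 @ Suc i # map (merge_letter i m) t2"
  let ?y = "map G t1 @ Suc j # map G t2"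
  have w: "?w ! p = (if p = ?n then Suc i else merge_letter i m (t ! p))"
    and y: "?y ! p = (if p = ?n then Suc j else G (t ! p))" if "p < length t" for p
    using that by (auto simp: t nth_append nth_Cons split: nat.split)
  have Gmono: "G a \<le> G b" if "a \<le> b" for a b
    using lvl_mono[OF perm that] that by (auto simp: G)
  \<comment> \<open>The shift by \<open>e\<close> is monotone in the value, so a tie under
    \<open>G\<close> is already a tie of levels and is decided by position.\<close>
  have Geq: "lvl t a = lvl t b" if "a \<le> b" "G a = G b" for a b
    using lvl_mono[OF perm that(1)] that by (auto simp: G split: if_splits)
  fix p q assume "p < length ?w" "q < length ?w" and less: "wless ?w p q"
  then have pq: "p < length t" "q < length t" by (auto simp: t)
  have ne: "p \<noteq> q" using less wless_irrefl by blast
  have dist: "t ! p \<noteq> t ! q" using ne pq perm by (metis is_perm_def nth_eq_iff_index_eq)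
  define a b where "a = t ! p" and "b = t ! q"
  have ord: "p < q" if "a < b" "lvl t a = lvl t b"
    using lvl_eq_order[OF perm pq] that unfolding a_def b_def .
  consider "p = ?n" "q \<noteq> ?n" | "q = ?n" "p \<noteq> ?n" | "p \<noteq> ?n" "q \<noteq> ?n" using ne by blast
  then show "wless ?y p q"
  proof cases
    case 1
    then have "Suc i < merge_letter i m b \<or> Suc i = merge_letter i m b \<and> p < q"
      using less w[OF pq(1)] w[OF pq(2)] by (auto simp: wless_def b_def)
    then have "Suc j < G b \<or> Suc j = G b \<and> p < q"
    proof
      assume "Suc i < merge_letter i m b"
      then have b: "i + 2 * m < b" by (auto simp: merge_letter_def split: if_splits)
      then have "Suc j \<le> lvl t b" using up[of "i + 2 * m"] lvl_mono[OF perm, of "i + 2 * m" b] m by simp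
      \<comment> \<open>This is where \<open>cond\<close> enters: for \<open>e = 0\<close> a letter
        beyond the interval can tie with the changed letter at \<open>j + 1\<close>, and then it has
        to stand to its right.\<close>
      moreover have "p < q" if "e = 0" "lvl t b = Suc j"
      proof (rule ccontr)
        assume "\<not> p < q"
        then have "b \<in> set t1" using 1 ne pq by (simp add: b_def t nth_append)
        then show False using cond that b by auto
      qed
      ultimately show ?thesis using b by (cases "e = 0") (auto simp: G le_less)
    next
      assume *: "Suc i = merge_letter i m b \<and> p < q"
      then have "upper i m b" using merge_letter_eq_iff(2)[OF m, of i b] by simp
      then show ?thesis using * up[of b] by (simp add: G)
    qed
    then show ?thesis using 1 y[OF pq(1)] y[OF pq(2)] by (auto simp: wless_def b_def)
  next
    case 2
    then have "merge_letter i m a < Suc i \<or> merge_letter i m a = Suc i \<and> p < q"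
      using less w[OF pq(1)] w[OF pq(2)] by (auto simp: wless_def a_def)
    then have "G a < Suc j \<or> G a = Suc j \<and> p < q"
    proof
      assume "merge_letter i m a < Suc i"
      then have a: "a \<le> i + m" by (auto simp: merge_letter_def split: if_splits)
      then have "lvl t a \<le> j" using lo[of "i + m"] lvl_mono[OF perm, of a "i + m"] by simp
      then show ?thesis using a by (simp add: G)
    next
      assume *: "merge_letter i m a = Suc i \<and> p < q"
      then have "upper i m a" using merge_letter_eq_iff(2)[OF m, of i a] by simp
      then show ?thesis using * up[of a] by (simp add: G)
    qed
    then show ?thesis using 2 y[OF pq(1)] y[OF pq(2)] by (auto simp: wless_def a_def)
  next
    case 3
    then have "merge_letter i m a < merge_letter i m b \<or> merge_letter i m a = merge_letter i m b \<and> p < q"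
      using less w[OF pq(1)] w[OF pq(2)] by (auto simp: wless_def a_def b_def)
    then have "G a < G b \<or> G a = G b \<and> p < q"
    proof
      assume "merge_letter i m a < merge_letter i m b"
      then have ab: "a < b" by (auto simp: merge_letter_def split: if_splits)
      then show ?thesis using Gmono[of a b] Geq[of a b] ord by (auto simp: le_less)
    next
      assume *: "merge_letter i m a = merge_letter i m b \<and> p < q"
      then have "lower i m a \<and> lower i m b \<or> upper i m a \<and> upper i m b"
        using dist m by (auto simp: merge_letter_def a_def b_def split: if_splits)
      then show ?thesis using * lo[of a] lo[of b] up[of a] up[of b] by (auto simp: G)
    qed
    then show ?thesis using 3 y[OF pq(1)] y[OF pq(2)] by (auto simp: wless_def a_def b_def)
  qed
qed simp

text \<open>Both sides say that none of \<open>a\<close>, ..., \<open>b - 2\<close> is a descent: a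
  descent \<open>x\<close> would put \<open>Suc x\<close> before \<open>x\<close> in the filtered
  word, and conversely letters of one level occur in increasing order.\<close>

lemma upt_filter_iff_lvl_const:
  assumes perm: "is_perm t" and ab: "1 \<le> a" "b \<le> Suc (length t)"
  shows "filter (\<lambda>x. a \<le> x \<and> x < b) t = [a..<b] \<longleftrightarrow> (\<forall>x. a \<le> x \<and> x < b \<longrightarrow> lvl t x = lvl t a)"
proof
  assume F: "filter (\<lambda>x. a \<le> x \<and> x < b) t = [a..<b]"
  have no: "x \<notin> wdes t" if x: "a \<le> x" "Suc x < b" for x
  proof
    assume "x \<in> wdes t"
    then obtain q p where qp: "q < p" "p < length t" "t ! q = Suc x" "t ! p = x" by (auto simp: wdes_def)
    have "t = take q t @ Suc x # drop (Suc q) t" using qp id_take_nth_drop[of q t] by simp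
    then have "[a..<b] = filter (\<lambda>x. a \<le> x \<and> x < b) (take q t) @ Suc x # filter (\<lambda>x. a \<le> x \<and> x < b) (drop (Suc q) t)"
      using F x by (metis (no_types, lifting) filter.simps(2) filter_append le_SucI)
    moreover have "x \<in> set (filter (\<lambda>x. a \<le> x \<and> x < b) (drop (Suc q) t))"
    proof -
      have "drop (Suc q) t ! (p - Suc q) = x" "p - Suc q < length (drop (Suc q) t)" using qp by auto
      then have "x \<in> set (drop (Suc q) t)" by (metis nth_mem)
      then show ?thesis using x by simp
    qed
    moreover have "sorted [a..<b]" by simp
    ultimately have "Suc x \<le> x" by (metis sorted_append sorted_simps(2))
    then show False by simp
  qed
  have "a \<le> x \<Longrightarrow> x < b \<Longrightarrow> lvl t x = lvl t a" for x
  proof (induction x rule: dec_induct)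
    case (step x)
    then show ?case using no[of x] lvl_Suc[OF perm, of x] by simp
  qed simp
  then show "\<forall>x. a \<le> x \<and> x < b \<longrightarrow> lvl t x = lvl t a" by blast
next
  assume C: "\<forall>x. a \<le> x \<and> x < b \<longrightarrow> lvl t x = lvl t a"
  let ?F = "filter (\<lambda>x. a \<le> x \<and> x < b) t"
  have "sorted_wrt (\<lambda>x y. lvl t x = lvl t y \<longrightarrow> x < y) ?F"
    using lvl_sorted_wrt[OF perm] by (rule sorted_wrt_filter)
  then have "sorted_wrt (<) ?F"
  proof (rule sorted_wrt_mono_rel[rotated])
    fix x y assume "x \<in> set ?F" "y \<in> set ?F" "lvl t x = lvl t y \<longrightarrow> x < y"
    then show "x < y" using C[rule_format, of x] C[rule_format, of y] by simp
  qed
  moreover have "set ?F = {a..<b}" using perm ab by (auto simp: is_perm_def)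
  ultimately show "?F = [a..<b]"
    by (metis sorted_list_of_set.idem_if_sorted_distinct sorted_list_of_set_range strict_sorted_iff)
qed

text \<open>The trace of the first column on the reading word, and all that the word-level arguments
  on edges use of the shape. The bound \<open>card (wdes t)\<close> is one less than the number of
  levels.\<close>

definition preceded :: "nat list \<Rightarrow> bool" where
  "preceded t \<longleftrightarrow> (\<forall>p<length t. lvl t (t ! p) \<le> card (wdes t) \<longrightarrow> (\<exists>q<p. lvl t (t ! q) = Suc (lvl t (t ! p))))"

section \<open>From skeleton edges to crystal edges\<close>

lemma lvl_surj:
  assumes "is_perm t" "1 \<le> length t" "1 \<le> a" "a \<le> Suc (card (wdes t))"
  obtains p where "p < length t" "lvl t (t ! p) = a"
proof -
  have "\<exists>x\<in>{1..n}. lvl t x = a" if "1 \<le> n" "a \<le> lvl t n" for n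
    using that
  proof (induction n rule: dec_induct)
    case base
    then show ?case using lvl_one[OF assms(1)] assms(3) by auto
  next
    case (step n)
    show ?case
    proof (cases "a \<le> lvl t n")
      case True
      then show ?thesis using step.IH by auto
    next
      case False
      then have "lvl t (Suc n) = a" using step.prems lvl_Suc[OF assms(1), of n] by (auto split: if_splits)
      then show ?thesis by (intro bexI[of _ "Suc n"]) auto
    qed
  qed
  from this[of "length t"] obtain x where "x \<in> set t" "lvl t x = a"
    using assms lvl_length[OF assms(1)] by (auto simp: is_perm_def)
  then show ?thesis using that by (metis in_set_conv_nth)
qed

text \<open>Hypothesis \<open>card\<close> is the trace of the target being a vertex of the induced
  subgraph. The last conclusion counts \<open>m\<close> from \<open>t\<close> and \<open>j\<close>
  alone and serves injectivity on edges.\<close>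

lemma edge_forward:
  assumes perm: "is_perm t" and prec: "preceded t"
    and dyck: "dyck_interval t i m"
    and f: "f_word i (map (merge_letter i m) t) = Some c"
    and card: "card (wdes (std_word c)) = card (wdes t)"
    and j: "j = lvl t (i + m)"
  shows "i + m \<in> wdes t"
    and "\<And>y. lower i m y \<Longrightarrow> lvl t y = j"
    and "\<And>y. upper i m y \<Longrightarrow> lvl t y = Suc j"
    and "f_word j (map (lvl t) t) = Some (map (lvl (std_word c)) (std_word c))"
    and "\<exists>t1 x t2. t = t1 @ x # t2 \<and> length t1 = last (unbr j 0 0 (map (lvl t) t))
      \<and> m = length (filter (\<lambda>y. lvl t y = Suc j) t1) + length (filter (\<lambda>y. lvl t y = j) t2)"
proof -
  have m: "1 \<le> m" "1 \<le> i" "i + 2 * m \<le> length t"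
    and F1: "filter (lower i m) t = [i..<i + m + 1]"
    and F2: "filter (upper i m) t = [i + m + 1..<i + 2 * m + 1]"
    and sd: "suffix_dom (lower i m) (upper i m) t"
    using dyck unfolding dyck_interval_iff by auto
  let ?l = "Suc (card (wdes t))"
  have w1: "filter (\<lambda>x. i \<le> x \<and> x < i + m + 1) t = [i..<i + m + 1]"
    using F1 by (simp add: less_Suc_eq_le)
  then have lo0: "\<forall>x. i \<le> x \<and> x < i + m + 1 \<longrightarrow> lvl t x = lvl t i"
    by (rule upt_filter_iff_lvl_const[OF perm, THEN iffD1, rotated 2]) (use m in simp_all)
  show lo: "lvl t y = j" if "lower i m y" for y
    using that j lo0[rule_format, of y] lo0[rule_format, of "i + m"] by simp
  have w2: "filter (\<lambda>x. i + m + 1 \<le> x \<and> x < i + 2 * m + 1) t = [i + m + 1..<i + 2 * m + 1]"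
    using F2 by (simp add: less_Suc_eq_le Suc_le_eq)
  then have up0: "\<forall>x. i + m + 1 \<le> x \<and> x < i + 2 * m + 1 \<longrightarrow> lvl t x = lvl t (i + m + 1)"
    by (rule upt_filter_iff_lvl_const[OF perm, THEN iffD1, rotated 2]) (use m in simp_all)
  have up': "lvl t y = lvl t (Suc (i + m))" if "upper i m y" for y
    using that up0[rule_format, of y] by simp
  have srt: "sorted_wrt (\<lambda>a b. lvl t a = lvl t b \<longrightarrow> a < b) t" by (rule lvl_sorted_wrt[OF perm])
  \<comment> \<open>Otherwise \<open>i + m + 1\<close> has level \<open>j\<close> as well, so the
    letters of level \<open>j\<close> on its right are larger; but as an upper letter it is
    bracketed with a lower letter on its right.\<close>
  show des: "i + m \<in> wdes t"
  proof (rule ccontr)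
    assume "i + m \<notin> wdes t"
    then have j': "lvl t (Suc (i + m)) = j" using lvl_Suc[OF perm, of "i + m"] j by simp
    have "Suc (i + m) \<in> set t" using m perm by (auto simp: is_perm_def)
    then obtain u v where uv: "t = u @ Suc (i + m) # v" by (metis split_list)
    have "suffix_dom (lower i m) (upper i m) (Suc (i + m) # v)"
      using sd suffix_dom_appendD unfolding uv by blast
    from suffix_dom_length[OF this] have "filter (lower i m) v \<noteq> []" using m by auto
    then obtain y where y: "y \<in> set v" "lower i m y" by (auto simp: filter_empty_conv)
    then have "Suc (i + m) < y" using srt lo[of y] j' unfolding uv by (auto simp: sorted_wrt_append)
    then show False using y by simp
  qed
  then have lvS: "lvl t (Suc (i + m)) = Suc j" using lvl_Suc[OF perm, of "i + m"] j by simp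
  show up: "lvl t y = Suc j" if "upper i m y" for y using up'[OF that] lvS by simp
  have jl: "j < ?l" using lvl_le[OF perm, of "Suc (i + m)"] lvS by simp
  have j1: "1 \<le> j" using lvl_pos j by simp
  have le_j: "y \<le> i + m" if "lvl t y \<le> j" for y
    using that lvl_mono[OF perm, of "Suc (i + m)" y] lvS by (cases "y \<le> i + m") auto
  have gt_j: "i + m < y" if "j < lvl t y" for y
    using that lvl_mono[OF perm, of y "i + m"] j by (cases "y \<le> i + m") auto
  obtain t1 x t2 where t: "t = t1 @ x # t2" and x: "lower i m x"
    and c: "c = map (merge_letter i m) t1 @ Suc i # map (merge_letter i m) t2"
    and sd1: "suffix_dom (lower i m) (upper i m) t1" and pd2: "prefix_dom (lower i m) (upper i m) t2"
    using f unfolding f_word_merge_iff[OF m(1)] by blast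
  let ?n = "length t1"
  have n: "?n < length t" "t ! ?n = x" by (auto simp: t)
  have lvx: "lvl t x = j" using lo x by simp
  have prec': "\<exists>q<p. lvl t (t ! q) = Suc (lvl t (t ! p))" if "p < length t" "lvl t (t ! p) < ?l" for p
    using prec that unfolding preceded_def by simp
  have mem1: "y \<in> set t1" if "q < ?n" "y = t ! q" for q y using that by (auto simp: t nth_append)
  have sub1: "set t1 \<subseteq> set t" using t by auto
  \<comment> \<open>\<open>i + m + 1\<close> is the leftmost letter of level \<open>j + 1\<close>,
    and by \<open>prec\<close> some letter of that level precedes \<open>x\<close>.\<close>
  have first: "Suc (i + m) \<in> set t1"
  proof -
    obtain q where q: "q < ?n" "lvl t (t ! q) = Suc j" using prec'[OF n(1)] lvx n jl by auto
    show ?thesis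
    proof (cases "t ! q = Suc (i + m)")
      case True
      then show ?thesis using mem1[OF q(1)] by simp
    next
      case False
      then have lt: "Suc (i + m) < t ! q" using gt_j[of "t ! q"] q by simp
      have "Suc (i + m) \<in> set t" using m perm by (auto simp: is_perm_def)
      then obtain p where p: "p < length t" "t ! p = Suc (i + m)" by (metis in_set_conv_nth)
      then have "p < q" using lvl_eq_order[OF perm p(1), of q] q n lt lvS by simp
      then show ?thesis using mem1[of p] q p by simp
    qed
  qed
  obtain t3 t4 where t34: "t1 = t3 @ Suc (i + m) # t4" using first by (metis split_list)
  have "suffix_dom (lower i m) (upper i m) (Suc (i + m) # t4)"
    using sd1 suffix_dom_appendD unfolding t34 by blast
  from suffix_dom_length[OF this] have "filter (lower i m) t4 \<noteq> []" using m by auto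
  \<comment> \<open>\<open>z\<close> is a lower letter between \<open>i + m + 1\<close> and
    \<open>x\<close>. It keeps the letter \<open>j\<close> when \<open>x\<close> is changed, so a
    \<open>j + 1\<close> still precedes a \<open>j\<close>.\<close>
  then obtain z where z: "z \<in> set t4" "lower i m z" by (auto simp: filter_empty_conv)
  then obtain k where k: "k < length t4" "t4 ! k = z" by (metis in_set_conv_nth)
  define pz where "pz = Suc (length t3) + k"
  have pz: "pz < ?n" "t ! pz = z" "length t3 < pz" "t ! length t3 = Suc (i + m)"
    using k by (auto simp: pz_def t t34 nth_append)
  \<comment> \<open>Both cases at once. With \<open>e = 1\<close> a letter of level
    \<open>j + 1\<close> beyond the interval stands left of \<open>x\<close>; level
    \<open>j + 1\<close> breaks in two and all letters beyond the interval move up by one. With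
    \<open>e = 0\<close> only the level of \<open>x\<close> changes.\<close>
  have count: "card (wdes (std_word c)) = card (wdes t) + e
      \<and> map (lvl (std_word c)) (std_word c) = map G t1 @ Suc j # map G t2"
    if e: "e \<in> {0, 1}" and G: "\<And>y. G y = lvl t y + (if i + 2 * m < y then e else 0)"
      and c0: "e = 0 \<Longrightarrow> \<forall>y\<in>set t1. lvl t y = Suc j \<longrightarrow> y \<le> i + 2 * m"
      and c1: "e = 1 \<Longrightarrow> \<exists>y\<in>set t1. lvl t y = Suc j \<and> i + 2 * m < y"
    for e G
  proof -
    let ?Y = "map G t1 @ Suc j # map G t2"
    have eq: "std_word c = std_word ?Y"
      unfolding c by (rule std_word_merge[OF perm t m(1) x]) (use lo up G c0 in auto)
    have Y: "?Y ! p = (if p = ?n then Suc j else G (t ! p))" if "p < length t" for p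
      using that by (auto simp: t nth_append nth_Cons split: nat.split)
    have lenY: "length ?Y = length t" by (simp add: t)
    have Glow: "G y = lvl t y" if "lvl t y \<le> j" for y using le_j[OF that] by (simp add: G)
    have wk: "\<exists>q p. q < p \<and> p < length ?Y \<and> ?Y ! q = Suc a \<and> ?Y ! p = a"
      if a: "1 \<le> a" "a < ?l + e" for a
    proof -
      consider "a = j" | "a < j" | "j < a" "e = 0" | "a = Suc j" "e = 1" | "Suc j < a" "e = 1"
        using e by fastforce
      then show ?thesis
      proof cases
        case 1
        have "?Y ! length t3 = Suc j" "?Y ! pz = j"
          using Y[of "length t3"] Y[of pz] pz n lvS lo[OF z(2)] z(2) m by (auto simp: G)
        then show ?thesis using 1 pz n lenY by (intro exI[of _ "length t3"] exI[of _ pz]) simp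
      next
        case 2
        obtain p where p: "p < length t" "lvl t (t ! p) = a"
          using lvl_surj[OF perm, of a] m a jl 2 by auto
        obtain q where q: "q < p" "lvl t (t ! q) = Suc a" using prec'[OF p(1)] p 2 jl by auto
        have pn: "p \<noteq> ?n" using p 2 n lvx by auto
        have Yp: "?Y ! p = a" using Y[OF p(1)] pn Glow[of "t ! p"] p 2 by simp
        show ?thesis
        proof (cases "q = ?n")
          case False
          then have "?Y ! q = Suc a" using Y[of q] Glow[of "t ! q"] q p 2 by simp
          then show ?thesis using Yp q p lenY by auto
        next
          case True
          \<comment> \<open>The witness was the changed letter, which is now \<open>j + 1\<close>;
            position \<open>pz\<close> carries \<open>j\<close> and lies further left.\<close>
          then have "Suc a = j" using q n lvx by simp
          then have "?Y ! pz = Suc a" using Y[of pz] pz n lo[OF z(2)] Glow[of z] by simp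
          then show ?thesis using Yp True pz q p lenY by (intro exI[of _ pz] exI[of _ p]) simp
        qed
      next
        case 3
        obtain p where p: "p < length t" "lvl t (t ! p) = a"
          using lvl_surj[OF perm, of a] m a 3 by auto
        obtain q where q: "q < p" "lvl t (t ! q) = Suc a" using prec'[OF p(1)] p 3 a by auto
        have "p \<noteq> ?n" "q \<noteq> ?n" using p q 3 n lvx by auto
        then have "?Y ! p = a" "?Y ! q = Suc a" using Y[of p] Y[of q] p q 3 by (auto simp: G)
        then show ?thesis using q p lenY by auto
      next
        case 4
        obtain y where y: "y \<in> set t1" "lvl t y = Suc j" "i + 2 * m < y" using c1 4 by blast
        then obtain q where q: "q < ?n" "t1 ! q = y" by (metis in_set_conv_nth)
        then have "t ! q = y" by (simp add: t nth_append)
        then have "?Y ! q = Suc a" "?Y ! ?n = a" using Y[of q] Y[of ?n] q n y 4 by (auto simp: G)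
        then show ?thesis using q n lenY by (intro exI[of _ q] exI[of _ ?n]) simp
      next
        case 5
        \<comment> \<open>The new letter \<open>a\<close> sits on a letter beyond the interval of
          old level \<open>a - 1\<close>. Level \<open>j + 1\<close> also contains upper letters
          that are not raised, so for \<open>a = j + 2\<close> the letter provided by
          \<open>c1\<close> is taken.\<close>
        have "\<exists>p<length t. Suc (lvl t (t ! p)) = a \<and> i + 2 * m < t ! p"
        proof (cases "a = Suc (Suc j)")
          case True
          obtain y where "y \<in> set t1" "lvl t y = Suc j" "i + 2 * m < y" using c1 5 by blast
          then show ?thesis using True sub1 by (metis in_set_conv_nth subsetD)
        next
          case False
          then obtain a' where a': "a = Suc a'" "Suc j < a'" "a' \<le> ?l" using 5 a by (cases a) auto
          obtain p where p: "p < length t" "lvl t (t ! p) = a'"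
            using lvl_surj[OF perm, of a'] m a' by auto
          have "i + 2 * m < t ! p"
            using up[of "i + 2 * m"] lvl_mono[OF perm, of "t ! p" "i + 2 * m"] p a' m
            by (cases "i + 2 * m < t ! p") auto
          then show ?thesis using p a' by auto
        qed
        then obtain p where p: "p < length t" "Suc (lvl t (t ! p)) = a" "i + 2 * m < t ! p" by blast
        then obtain q where q: "q < p" "lvl t (t ! q) = a" using prec'[OF p(1)] a 5 by auto
        have "i + 2 * m < t ! q"
          using up[of "i + 2 * m"] lvl_mono[OF perm, of "t ! q" "i + 2 * m"] q 5 m
          by (cases "i + 2 * m < t ! q") auto
        moreover have "p \<noteq> ?n" "q \<noteq> ?n" using p q 5 n lvx by auto
        ultimately have "?Y ! p = a" "?Y ! q = Suc a" using Y[of p] Y[of q] p q 5 by (auto simp: G)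
        then show ?thesis using q p lenY by auto
      qed
    qed
    have set: "set ?Y = {1..?l + e}"
    proof
      have "G y \<in> {1..?l + e}" for y using lvl_pos[of t y] lvl_le[OF perm, of y] by (auto simp: G)
      then show "set ?Y \<subseteq> {1..?l + e}" using jl by auto
      show "{1..?l + e} \<subseteq> set ?Y"
      proof
        fix a assume a: "a \<in> {1..?l + e}"
        show "a \<in> set ?Y"
        proof (cases "a < ?l + e")
          case True
          have "1 \<le> a" using a by simp
          from wk[OF this True] obtain p where "p < length ?Y" "?Y ! p = a" by blast
          then show ?thesis by (metis nth_mem)
        next
          case False
          then obtain a' where a': "a = Suc a'" using a by (cases a) auto
          then have "1 \<le> a'" "a' < ?l + e" using False a jl j1 by auto
          from wk[OF this] obtain q p where "q < p" "p < length ?Y" "?Y ! q = Suc a'"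
            by blast
          then show ?thesis using a' by (metis nth_mem order.strict_trans)
        qed
      qed
    qed
    have "1 \<le> ?l + e" by simp
    from lvl_std_word[OF set this wk eq] show ?thesis by simp
  qed
  have cond: "\<forall>y\<in>set t1. lvl t y = Suc j \<longrightarrow> y \<le> i + 2 * m"
  proof (rule ccontr)
    assume "\<not> ?thesis"
    then have "\<exists>y\<in>set t1. lvl t y = Suc j \<and> i + 2 * m < y" by force
    then have "card (wdes (std_word c)) = card (wdes t) + 1"
      using count[of 1 "\<lambda>y. lvl t y + (if i + 2 * m < y then 1 else 0)"] by auto
    then show False using card by simp
  qed
  have res: "map (lvl (std_word c)) (std_word c) = map (lvl t) t1 @ Suc j # map (lvl t) t2"
    using count[of 0 "lvl t"] cond by auto
  have up1: "lvl t y = Suc j \<longleftrightarrow> upper i m y" if "y \<in> set t1" for y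
  proof
    assume y: "lvl t y = Suc j"
    then have "i + m < y" using gt_j[of y] by simp
    moreover have "y \<le> i + 2 * m" using y cond[rule_format, OF that] by blast
    ultimately show "upper i m y" ..
  qed (rule up)
  have lo2: "lvl t y = j \<longleftrightarrow> lower i m y" if "y \<in> set t2" for y
  proof
    assume "lvl t y = j"
    moreover then have "x < y" using srt that lvx unfolding t by (auto simp: sorted_wrt_append)
    ultimately show "lower i m y" using le_j[of y] x by simp
  qed (use lo in blast)
  \<comment> \<open>Passing from the interval to levels adds at most letters \<open>j\<close> on the
    left of \<open>x\<close>, those below \<open>i\<close>, and letters \<open>j + 1\<close> on its
    right, those beyond the interval; both preserve domination.\<close>
  have SD: "suffix_dom (\<lambda>y. lvl t y = j) (\<lambda>y. lvl t y = Suc j) t1"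
    using sd1 by (rule suffix_dom_mono) (use lo up1 in auto)
  have PD: "prefix_dom (\<lambda>y. lvl t y = j) (\<lambda>y. lvl t y = Suc j) t2"
    using pd2 by (rule prefix_dom_mono) (use lo2 up in auto)
  show "f_word j (map (lvl t) t) = Some (map (lvl (std_word c)) (std_word c))"
    unfolding f_word_map_iff using t lvx res SD PD by blast
  \<comment> \<open>\<open>t2\<close> is dominated in both directions, as a suffix of
    \<open>t\<close> and by the choice of \<open>x\<close>, so it has equally many lower and upper
    letters. Hence the \<open>m\<close> upper letters are counted by those before \<open>x\<close>
    plus the lower letters after \<open>x\<close>.\<close>
  have "length (filter (lower i m) t) = m + 1" "length (filter (upper i m) t) = m"
    unfolding F1 F2 by auto
  then have "length (filter (lower i m) t1) + length (filter (lower i m) t2) = m"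
    "length (filter (upper i m) t1) + length (filter (upper i m) t2) = m"
    using x by (auto simp: t)
  moreover have "length (filter (upper i m) t2) \<le> length (filter (lower i m) t2)"
    using sd suffix_dom_appendD[of _ _ "t1 @ [x]" t2] suffix_dom_length unfolding t by force
  moreover have "length (filter (lower i m) t2) \<le> length (filter (upper i m) t2)"
    using pd2 prefix_dom_length by blast
  moreover have "filter (\<lambda>y. lvl t y = Suc j) t1 = filter (upper i m) t1"
    using up1 by (intro filter_cong) auto
  moreover have "filter (\<lambda>y. lvl t y = j) t2 = filter (lower i m) t2"
    using lo2 by (intro filter_cong) auto
  ultimately have "m = length (filter (\<lambda>y. lvl t y = Suc j) t1) + length (filter (\<lambda>y. lvl t y = j) t2)"
    by simp
  moreover have "length t1 = last (unbr j 0 0 (map (lvl t) t))"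
    using last_unbr(2)[of j "map (lvl t) t1" "map (lvl t) t2"] SD PD lvx
    by (simp add: suffix_dom_map prefix_dom_map t)
  ultimately show "\<exists>t1 x t2. t = t1 @ x # t2 \<and> length t1 = last (unbr j 0 0 (map (lvl t) t))
      \<and> m = length (filter (\<lambda>y. lvl t y = Suc j) t1) + length (filter (\<lambda>y. lvl t y = j) t2)"
    using t by blast
qed

section \<open>From crystal edges to skeleton edges\<close>

lemma lvl_threshold:
  assumes "is_perm t"
  obtains c where "c \<le> length t" "\<And>x. 1 \<le> x \<Longrightarrow> x \<le> length t \<Longrightarrow> lvl t x \<le> j \<longleftrightarrow> x \<le> c"
proof -
  have "\<exists>c\<le>n. \<forall>x. 1 \<le> x \<and> x \<le> n \<longrightarrow> (lvl t x \<le> j \<longleftrightarrow> x \<le> c)" for n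
  proof (induction n)
    case (Suc n)
    then obtain c where c: "c \<le> n" "\<forall>x. 1 \<le> x \<and> x \<le> n \<longrightarrow> (lvl t x \<le> j \<longleftrightarrow> x \<le> c)" by blast
    show ?case
    proof (cases "lvl t (Suc n) \<le> j")
      case True
      then have "lvl t x \<le> j" if "x \<le> Suc n" for x using lvl_mono[OF assms that] by simp
      then show ?thesis by (intro exI[of _ "Suc n"]) auto
    next
      case False
      then have "lvl t x \<le> j \<longleftrightarrow> x \<le> c" if "1 \<le> x" "x \<le> Suc n" for x
        using that c(1) c(2)[rule_format, of x] by (cases "x = Suc n") auto
      then show ?thesis using c(1) by (intro exI[of _ c]) auto
    qed
  qed simp
  then show ?thesis using that by blast
qed

lemma upt_eq_appendD:
  assumes "[a..<b] = ys @ zs"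
  shows "ys = [a..<a + length ys]" "zs = [a + length ys..<b]"
proof -
  have "length ys \<le> b - a" using arg_cong[OF assms, of length] by simp
  then have "ys = [] \<or> a + length ys \<le> b" by (cases ys) auto
  then show "ys = [a..<a + length ys]"
    using arg_cong[OF assms, of "take (length ys)"] by (auto simp: take_upt)
  show "zs = [a + length ys..<b]"
    using arg_cong[OF assms, of "drop (length ys)"] by simp
qed

lemma filter_take: "filter P (take n u) = take (length (filter P (take n u))) (filter P u)"
  by (metis append_eq_conv_conj append_take_drop_id filter_append)

lemma filter_drop: "filter P (drop n u) = drop (length (filter P (take n u))) (filter P u)"
  by (metis append_eq_conv_conj append_take_drop_id filter_append)

lemma length_filter_upt_ge: "length (filter (\<lambda>y. i \<le> y) [a..<b]) = b - max i a"
  by (induction b) auto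

lemma length_filter_upt_less: "length (filter (\<lambda>y. y < c) [a..<b]) = min b c - a"
  by (induction b) auto

lemma length_filter_le_imp:
  assumes "\<And>y. y \<in> set u \<Longrightarrow> P y \<Longrightarrow> Q y"
  shows "length (filter P u) \<le> length (filter Q u)"
  using assms by (induction u) auto

text \<open>The interval is read off from \<open>x\<close>: the \<open>s\<close> letters
  \<open>j + 1\<close> before \<open>x\<close> are to be matched with the last \<open>s\<close>
  letters \<open>j\<close> before \<open>x\<close>, and the \<open>k\<close> letters
  \<open>j\<close> after \<open>x\<close> with the first \<open>k\<close> letters
  \<open>j + 1\<close> after \<open>x\<close>. Hence \<open>m = s + k\<close>, and the interval
  starts at \<open>x - s\<close>.\<close>

lemma edge_backward:
  assumes perm: "is_perm t" and prec: "preceded t"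
    and f: "f_word j (map (lvl t) t) = Some w'" and jl: "j \<le> card (wdes t)"
  obtains i m c where "dyck_interval t i m" "f_word i (map (merge_letter i m) t) = Some c"
    "std_word c = std_word w'"
proof -
  let ?N = "length t"
  obtain t1 x t2 where t: "t = t1 @ x # t2" and lvx: "lvl t x = j"
    and w': "w' = map (lvl t) t1 @ Suc j # map (lvl t) t2"
    and sd1: "suffix_dom (\<lambda>y. lvl t y = j) (\<lambda>y. lvl t y = Suc j) t1"
    and pd2: "prefix_dom (\<lambda>y. lvl t y = j) (\<lambda>y. lvl t y = Suc j) t2"
    using f unfolding f_word_map_iff by blast
  have rng: "1 \<le> y" "y \<le> ?N" if "y \<in> set t" for y using that perm by (auto simp: is_perm_def)
  have j1: "1 \<le> j" using lvl_pos lvx by metis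
  \<comment> \<open>\<open>E\<close>, \<open>D\<close> and \<open>F\<close> are the last values of
    level at most \<open>j - 1\<close>, \<open>j\<close> and \<open>j + 1\<close>; so level
    \<open>j\<close> is E + 1, ..., D and level \<open>j + 1\<close> is D + 1, ..., F.\<close>
  obtain E where E: "E \<le> ?N" "\<And>x. 1 \<le> x \<Longrightarrow> x \<le> ?N \<Longrightarrow> lvl t x \<le> j - 1 \<longleftrightarrow> x \<le> E"
    by (rule lvl_threshold[OF perm, where j = "j - 1"]) (rule that)
  obtain D where D: "D \<le> ?N" "\<And>x. 1 \<le> x \<Longrightarrow> x \<le> ?N \<Longrightarrow> lvl t x \<le> j \<longleftrightarrow> x \<le> D"
    by (rule lvl_threshold[OF perm, where j = j]) (rule that)
  obtain F where F: "F \<le> ?N" "\<And>x. 1 \<le> x \<Longrightarrow> x \<le> ?N \<Longrightarrow> lvl t x \<le> Suc j \<longleftrightarrow> x \<le> F"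
    by (rule lvl_threshold[OF perm, where j = "Suc j"]) (rule that)
  have lj: "lvl t y = j \<longleftrightarrow> E < y \<and> y \<le> D" if "1 \<le> y" "y \<le> ?N" for y
    using E(2)[OF that] D(2)[OF that] j1 by linarith
  have lSj: "lvl t y = Suc j \<longleftrightarrow> D < y \<and> y \<le> F" if "1 \<le> y" "y \<le> ?N" for y
    using D(2)[OF that] F(2)[OF that] by linarith
  have lj': "lvl t y = j" if "E < y" "y \<le> D" for y using that lj[of y] D(1) by simp
  have lSj': "lvl t y = Suc j" if "D < y" "y \<le> F" for y using that lSj[of y] F(1) by simp
  have xt: "x \<in> set t" by (simp add: t)
  have xED: "E < x" "x \<le> D" using lj[OF rng[OF xt]] lvx by auto
  have const: "filter (\<lambda>y. a < y \<and> y \<le> b) t = [Suc a..<Suc b]"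
    if "b \<le> ?N" "\<And>y. a < y \<Longrightarrow> y \<le> b \<Longrightarrow> lvl t y = l" for a b l
  proof -
    have "filter (\<lambda>y. Suc a \<le> y \<and> y < Suc b) t = [Suc a..<Suc b]"
    proof (rule upt_filter_iff_lvl_const[OF perm, THEN iffD2])
      have "lvl t y = lvl t (Suc a)" if "Suc a \<le> y" "y < Suc b" for y
        using that \<open>\<And>y. a < y \<Longrightarrow> y \<le> b \<Longrightarrow> lvl t y = l\<close>[of y]
          \<open>\<And>y. a < y \<Longrightarrow> y \<le> b \<Longrightarrow> lvl t y = l\<close>[of "Suc a"] by simp
      then show "\<forall>y. Suc a \<le> y \<and> y < Suc b \<longrightarrow> lvl t y = lvl t (Suc a)" by blast
    qed (use that in auto)
    then show ?thesis by (simp add: Suc_le_eq less_Suc_eq_le)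
  qed
  have "filter (\<lambda>y. lvl t y = j) t = filter (\<lambda>y. E < y \<and> y \<le> D) t"
    using lj rng by (intro filter_cong) auto
  then have "filter (\<lambda>y. lvl t y = j) t = [Suc E..<Suc D]"
    using const[OF D(1), of E j] lj' by simp
  then have *: "[Suc E..<Suc D] = filter (\<lambda>y. lvl t y = j) t1 @ x # filter (\<lambda>y. lvl t y = j) t2"
    using lvx by (simp add: t)
  have "Suc E + length (filter (\<lambda>y. lvl t y = j) t1) = x"
    using upt_eq_appendD(2)[OF *] by (metis list.inject upt_eq_Cons_conv)
  then have A1: "filter (\<lambda>y. lvl t y = j) t1 = [Suc E..<x]"
    and "[x..<Suc D] = x # filter (\<lambda>y. lvl t y = j) t2"
    using upt_eq_appendD[OF *] by auto
  then have A2: "filter (\<lambda>y. lvl t y = j) t2 = [Suc x..<Suc D]"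
    using xED by (auto simp: upt_conv_Cons simp del: upt_Suc)
  have "filter (\<lambda>y. lvl t y = Suc j) t = filter (\<lambda>y. D < y \<and> y \<le> F) t"
    using lSj rng by (intro filter_cong) auto
  then have "filter (\<lambda>y. lvl t y = Suc j) t = [Suc D..<Suc F]"
    using const[OF F(1), of D "Suc j"] lSj' by simp
  then have *: "[Suc D..<Suc F] = filter (\<lambda>y. lvl t y = Suc j) t1 @ filter (\<lambda>y. lvl t y = Suc j) t2"
    using lvx by (simp add: t)
  define s where "s = length (filter (\<lambda>y. lvl t y = Suc j) t1)"
  define k where "k = D - x"
  define m where "m = s + k"
  define i where "i = x - s"
  have B1: "filter (\<lambda>y. lvl t y = Suc j) t1 = [Suc D..<Suc D + s]"
    and B2: "filter (\<lambda>y. lvl t y = Suc j) t2 = [Suc D + s..<Suc F]"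
    using upt_eq_appendD[OF *] by (simp_all add: s_def)
  have s1: "1 \<le> s"
  proof -
    have "\<exists>q<length t1. lvl t (t ! q) = Suc j"
      using prec[unfolded preceded_def, rule_format, of "length t1"] lvx jl by (simp add: t)
    then obtain q where "q < length t1" "lvl t (t ! q) = Suc j" by blast
    then have "t1 ! q \<in> set (filter (\<lambda>y. lvl t y = Suc j) t1)" by (simp add: t nth_append)
    then show ?thesis unfolding s_def by (cases "filter (\<lambda>y. lvl t y = Suc j) t1") auto
  qed
  \<comment> \<open>Domination on \<open>t1\<close> leaves room for \<open>s\<close> letters of
    level \<open>j\<close> below \<open>x\<close>, so \<open>i = x - s\<close> still has level
    \<open>j\<close>.\<close>
  have sE: "E + s < x"
    using suffix_dom_length[OF sd1] A1 xED by (simp add: s_def del: upt_Suc)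
  have kF: "D + s + k \<le> F"
  proof -
    have "k \<le> Suc F - (Suc D + s)"
      using prefix_dom_length[OF pd2] unfolding A2 B2 by (simp add: k_def del: upt_Suc)
    moreover have "Suc D + s \<le> Suc F" using arg_cong[OF *, of length] s1 by (simp add: s_def del: upt_Suc)
    ultimately show ?thesis by simp
  qed
  have iE: "E < i" and im: "i + m = D" and i2m: "i + 2 * m = D + s + k"
    using sE xED by (auto simp: i_def m_def k_def)
  have m1: "1 \<le> m" using s1 by (simp add: m_def)
  have lo: "lvl t y = j" if "lower i m y" for y using that lj'[of y] iE im by simp
  have up: "lvl t y = Suc j" if "upper i m y" for y using that lSj'[of y] kF im i2m by simp
  have lo_iff: "lower i m y \<longleftrightarrow> lvl t y = j \<and> i \<le> y" if "y \<in> set t" for y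
    using lj[OF rng[OF that]] iE im by auto
  have up_iff: "upper i m y \<longleftrightarrow> lvl t y = Suc j \<and> y < Suc (D + s + k)" if "y \<in> set t" for y
    using lSj[OF rng[OF that]] kF im i2m by auto
  have sub: "y \<in> set t" if "y \<in> set t1 \<or> y \<in> set t2" for y using that by (auto simp: t)
  have SD1: "suffix_dom (lower i m) (upper i m) t1"
    unfolding suffix_dom_def
  proof
    fix n
    have mem: "y \<in> set t" if "y \<in> set (drop n t1)" for y using that sub in_set_dropD by fast
    obtain a where a: "filter (\<lambda>y. lvl t y = j) (drop n t1) = [a..<x]"
      using filter_drop[of "\<lambda>y. lvl t y = j" n t1] unfolding A1 by (metis drop_upt)
    have "filter (lower i m) (drop n t1) = filter (\<lambda>y. i \<le> y) (filter (\<lambda>y. lvl t y = j) (drop n t1))"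
      unfolding filter_filter by (rule filter_cong) (use lo_iff mem in auto)
    \<comment> \<open>The letters of level \<open>j\<close> in a suffix of \<open>t1\<close> form a
      final segment of \<open>[Suc E..<x]\<close>, and its top \<open>s\<close> values are the lower
      letters; hence the minimum.\<close>
    then have l: "length (filter (lower i m) (drop n t1)) = min s (length (filter (\<lambda>y. lvl t y = j) (drop n t1)))"
      using sE unfolding a by (simp only: length_filter_upt_ge) (auto simp: i_def)
    have "length (filter (upper i m) (drop n t1)) \<le> length (filter (\<lambda>y. lvl t y = Suc j) (drop n t1))"
      using up by (intro length_filter_le_imp) auto
    moreover have "length (filter (\<lambda>y. lvl t y = Suc j) (drop n t1)) \<le> s"
      unfolding filter_drop[of _ n t1] s_def by simp
    moreover have "length (filter (\<lambda>y. lvl t y = Suc j) (drop n t1)) \<le> length (filter (\<lambda>y. lvl t y = j) (drop n t1))"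
      using sd1 by (simp add: suffix_dom_def)
    ultimately show "length (filter (upper i m) (drop n t1)) \<le> length (filter (lower i m) (drop n t1))"
      unfolding l by simp
  qed
  have lo2: "filter (lower i m) (take n t2) = filter (\<lambda>y. lvl t y = j) (take n t2)" for n
  proof (rule filter_cong)
    fix y assume y: "y \<in> set (take n t2)"
    then have y2: "y \<in> set t2" by (rule in_set_takeD)
    have "x < y" if "lvl t y = j"
    proof -
      have "y \<in> set (filter (\<lambda>y. lvl t y = j) t2)" using y2 that by simp
      then show ?thesis unfolding A2 by auto
    qed
    then show "lower i m y \<longleftrightarrow> lvl t y = j" using lo_iff[of y] sub y2 by (auto simp: i_def)
  qed simp
  \<comment> \<open>Symmetrically, the upper letters in \<open>t2\<close> are its first
    \<open>k\<close> letters of level \<open>j + 1\<close>.\<close>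
  have up2: "length (filter (upper i m) (take n t2)) = min k (length (filter (\<lambda>y. lvl t y = Suc j) (take n t2)))" for n
  proof -
    have mem: "y \<in> set t" if "y \<in> set (take n t2)" for y using that sub in_set_takeD by fast
    have "\<exists>b\<le>Suc F. filter (\<lambda>y. lvl t y = Suc j) (take n t2) = [Suc D + s..<b]"
    proof -
      let ?c = "length (filter (\<lambda>y. lvl t y = Suc j) (take n t2))"
      have "filter (\<lambda>y. lvl t y = Suc j) (take n t2) = take ?c [Suc D + s..<Suc F]"
        by (subst filter_take) (simp only: B2)
      moreover have "take ?c [Suc D + s..<Suc F] = [Suc D + s..<min (Suc D + s + ?c) (Suc F)]"
        by (cases "Suc D + s + ?c \<le> Suc F") (simp_all add: take_upt min_def del: upt_Suc)
      ultimately show ?thesis by (metis min.cobounded2)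
    qed
    then obtain b where b: "filter (\<lambda>y. lvl t y = Suc j) (take n t2) = [Suc D + s..<b]" by blast
    have "filter (upper i m) (take n t2) = filter (\<lambda>y. y < Suc (D + s + k)) (filter (\<lambda>y. lvl t y = Suc j) (take n t2))"
      unfolding filter_filter by (rule filter_cong) (use up_iff mem in auto)
    then show ?thesis unfolding b by (simp only: length_filter_upt_less) auto
  qed
  have lk: "length (filter (\<lambda>y. lvl t y = j) (take n t2)) \<le> k" for n
  proof -
    have "length (filter (\<lambda>y. lvl t y = j) (take n t2)) \<le> length (filter (\<lambda>y. lvl t y = j) t2)"
      by (subst filter_take) simp
    then show ?thesis unfolding A2 by (simp add: k_def del: upt_Suc)
  qed
  have PD2: "prefix_dom (lower i m) (upper i m) t2"
    unfolding prefix_dom_def lo2 up2 using lk pd2 by (simp add: prefix_dom_def)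
  have "length (filter (lower i m) t2) = k"
    using lo2[of "length t2"] A2 by (simp add: k_def del: upt_Suc)
  moreover have "length (filter (upper i m) t2) \<le> k" using up2[of "length t2"] by simp
  ultimately have SD2: "suffix_dom (lower i m) (upper i m) t2"
    by (intro prefix_dom_imp_suffix_dom[OF PD2]) simp
  have x: "lower i m x" using xED im by (simp add: i_def)
  have "suffix_dom (lower i m) (upper i m) [x]"
    unfolding suffix_dom_def using x by (auto simp: drop_Cons split: nat.split)
  then have SD: "suffix_dom (lower i m) (upper i m) t"
    using suffix_dom_append[OF SD1 suffix_dom_append[OF _ SD2, of "[x]"]] by (simp add: t)
  have "filter (\<lambda>y. i - 1 < y \<and> y \<le> D) t = [Suc (i - 1)..<Suc D]"
    by (rule const[OF D(1), of _ j]) (use lj' iE in auto)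
  moreover have "i - 1 < y \<longleftrightarrow> i \<le> y" for y using iE by auto
  ultimately have F1: "filter (lower i m) t = [i..<i + m + 1]" using iE im by simp
  have "filter (\<lambda>y. D < y \<and> y \<le> D + s + k) t = [Suc D..<Suc (D + s + k)]"
    by (rule const[of _ _ "Suc j"]) (use lSj' kF F(1) in auto)
  then have F2: "filter (upper i m) t = [i + m + 1..<i + 2 * m + 1]" using im i2m by simp
  have dyck: "dyck_interval t i m"
    unfolding dyck_interval_iff using m1 iE kF F(1) i2m F1 F2 SD by auto
  have fw: "f_word i (map (merge_letter i m) t) = Some (map (merge_letter i m) t1 @ Suc i # map (merge_letter i m) t2)"
    unfolding f_word_merge_iff[OF m1] using t x SD1 PD2 by blast
  \<comment> \<open>All letters of level \<open>j + 1\<close> before \<open>x\<close> were taken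
    into the interval, so the case \<open>e = 0\<close> of the comparison applies.\<close>
  have "\<forall>y\<in>set t1. lvl t y = Suc j \<longrightarrow> y \<le> i + 2 * m"
  proof (intro ballI impI)
    fix y assume "y \<in> set t1" "lvl t y = Suc j"
    then have "y \<in> set (filter (\<lambda>y. lvl t y = Suc j) t1)" by simp
    then show "y \<le> i + 2 * m" unfolding B1 using i2m by auto
  qed
  from std_word_merge[OF perm t m1 x lo up _ this, where G = "lvl t" and e = 0]
  have "std_word (map (merge_letter i m) t1 @ Suc i # map (merge_letter i m) t2) = std_word w'"
    by (simp add: w')
  then show ?thesis using that dyck fw by blast
qed

subsection \<open>The bijection on edges\<close>

lemma f_word_updateD:
  assumes "f_word j w = Some w'"
  obtains p where "p < length w" "w ! p = j" "w' = w[p := Suc j]"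
proof -
  obtain u v where "w = u @ j # v" "w' = u @ Suc j # v" using assms by (auto simp: f_word_iff)
  then show ?thesis using that[of "length u"] by simp
qed

lemma row_merge_int: "row (merge_int i m T) = map (merge_letter i m) (row T)"
  by (simp add: merge_int_def merge_letter_def[abs_def] row_map_map)

lemma shape_merge_int: "shape (merge_int i m T) = shape T"
  by (simp add: merge_int_def shape_map_map)

lemma CS_edges_iff:
  "(T, (i, m), T') \<in> CS_edges lam \<longleftrightarrow> T \<in> SYT lam \<and> dyck_interval (row T) i m \<and> shape T' = lam \<and>
    (\<exists>c. f_word i (map (merge_letter i m) (row T)) = Some c \<and> row T' = std_word c)"
  (is "_ \<longleftrightarrow> ?R")
proof
  assume "(T, (i, m), T') \<in> CS_edges lam"
  then obtain c' where "T \<in> SYT lam" "dyck_interval (row T) i m"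
    "f_tab i (merge_int i m T) = Some c'" "T' = std c'"
    by (auto simp: CS_edges_def)
  then show ?R
    by (auto simp: f_tab_row row_merge_int shape_merge_int row_std shape_std SYT_def)
next
  assume ?R
  then obtain c where R: "T \<in> SYT lam" "dyck_interval (row T) i m" "shape T' = lam"
    "f_word i (map (merge_letter i m) (row T)) = Some c" "row T' = std_word c" by blast
  define c' where "c' = unrow lam c"
  have T: "shape T = lam" using R by (simp add: SYT_def)
  have len: "length c = sum_list lam"
    using length_row[of T'] unfolding R(3,5) by simp
  have c': "row c' = c" "shape c' = lam" using len by (simp_all add: c'_def row_unrow shape_unrow)
  then have "f_tab i (merge_int i m T) = Some c'"
    using R T by (simp add: f_tab_row row_merge_int shape_merge_int)
  moreover have "T' = std c'"
    using R c' by (intro row_eqD) (simp_all add: row_std shape_std)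
  ultimately show "(T, (i, m), T') \<in> CS_edges lam" using R by (auto simp: CS_edges_def)
qed

text \<open>The crystal label is the level of \<open>i + m\<close>, the last letter of the lower
  half of the interval.\<close>

definition edge_map ::
    "nat list list \<times> (nat \<times> nat) \<times> nat list list \<Rightarrow> nat list list \<times> nat \<times> nat list list" where
  "edge_map = (\<lambda>(T, (i, m), T'). (destd T, lvl (row T) (i + m), destd T'))"

context
  fixes lam :: "nat list"
  assumes part: "is_partition lam" and ne: "lam \<noteq> []"
begin

lemma vertex_facts:
  assumes "T \<in> CS_vertices_l lam (length lam)"
  shows "T \<in> SYT lam" "is_perm (row T)" "Suc (card (wdes (row T))) = length lam" "shape T = lam"
    "length (row T) = sum_list lam" "length (Des T) = length lam"
    "row (destd T) = map (lvl (row T)) (row T)" "shape (destd T) = lam" "preceded (row T)"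
proof -
  have pos: "0 < sum_list lam" using sum_list_partition_pos part ne .
  show S: "T \<in> SYT lam" and D: "length (Des T) = length lam"
    using assms by (auto simp: CS_vertices_l_def)
  show "is_perm (row T)" "shape T = lam" using SYT_perm S by (auto simp: SYT_def)
  show card: "Suc (card (wdes (row T))) = length lam" using length_Des[OF S pos] D by simp
  show row: "row (destd T) = map (lvl (row T)) (row T)" by (rule row_destd[OF S pos])
  show "shape (destd T) = lam" by (rule shape_destd[OF S pos])
  show "length (row T) = sum_list lam" by (rule length_row_SYT[OF S pos])
  have b: "destd T \<in> SSYT lam (length lam)" using destd_SSYT[OF S pos] D by simp
  show "preceded (row T)"
    unfolding preceded_def
  proof (intro allI impI)
    fix p assume "p < length (row T)" "lvl (row T) (row T ! p) \<le> card (wdes (row T))"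
    then show "\<exists>q<p. lvl (row T) (row T ! q) = Suc (lvl (row T) (row T ! p))"
      using SSYT_preceded[OF part b, of p] row card by (auto intro: less_trans)
  qed
qed

lemma CS_edges_l_facts:
  assumes "(T, (i, m), T') \<in> CS_edges_l lam (length lam)" and j: "j = lvl (row T) (i + m)"
  shows "T \<in> CS_vertices_l lam (length lam)" "T' \<in> CS_vertices_l lam (length lam)"
    and "i + m \<in> wdes (row T)" "(destd T, j, destd T') \<in> crystal_edges lam (length lam)"
    and "{i..i + m} \<subseteq> block (Des T) j" "{i + m + 1..i + 2 * m} \<subseteq> block (Des T) (Suc j)"
    and "\<exists>t1 x t2. row T = t1 @ x # t2 \<and> length t1 = last (unbr j 0 0 (map (lvl (row T)) (row T)))
      \<and> m = length (filter (\<lambda>y. lvl (row T) y = Suc j) t1) + length (filter (\<lambda>y. lvl (row T) y = j) t2)"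
proof -
  have pos: "0 < sum_list lam" using sum_list_partition_pos part ne .
  show T: "T \<in> CS_vertices_l lam (length lam)" and T': "T' \<in> CS_vertices_l lam (length lam)"
    using assms by (auto simp: CS_edges_l_def)
  note v = vertex_facts[OF T] and v' = vertex_facts[OF T']
  have "(T, (i, m), T') \<in> CS_edges lam" using assms by (auto simp: CS_edges_l_def)
  then obtain c where c: "dyck_interval (row T) i m"
    "f_word i (map (merge_letter i m) (row T)) = Some c" "row T' = std_word c"
    by (auto simp: CS_edges_iff)
  have card: "card (wdes (std_word c)) = card (wdes (row T))" using v(3) v'(3) c(3) by simp
  note fwd = edge_forward[OF v(2,9) c(1,2) card j]
  show "i + m \<in> wdes (row T)" by (rule fwd)
  show "\<exists>t1 x t2. row T = t1 @ x # t2 \<and> length t1 = last (unbr j 0 0 (map (lvl (row T)) (row T)))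
      \<and> m = length (filter (\<lambda>y. lvl (row T) y = Suc j) t1) + length (filter (\<lambda>y. lvl (row T) y = j) t2)"
    by (rule fwd)
  have "f_word j (row (destd T)) = Some (row (destd T'))"
    using fwd(4) v(7) v'(7) c(3) by simp
  then have "f_tab j (destd T) = Some (destd T')" using v(8) v'(8) by (simp add: f_tab_row)
  then show "(destd T, j, destd T') \<in> crystal_edges lam (length lam)"
    using bij_betw_destd[OF part ne] T T' by (auto simp: crystal_edges_def dest: bij_betwE)
  have rng: "1 \<le> m" "1 \<le> i" "i + 2 * m \<le> sum_list lam"
    using c(1) v(5) by (auto simp: dyck_interval_def)
  have j1: "1 \<le> j" using lvl_pos j by simp
  have jl: "Suc j \<le> length lam"
    using fwd(3)[of "Suc (i + m)"] lvl_le[OF v(2), of "Suc (i + m)"] v(3) rng by simp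
  show "{i..i + m} \<subseteq> block (Des T) j"
  proof
    fix y assume y: "y \<in> {i..i + m}"
    then show "y \<in> block (Des T) j"
      using fwd(2)[of y] block_Des_iff[OF v(1) pos, of j y] j1 jl v(6) rng by auto
  qed
  show "{i + m + 1..i + 2 * m} \<subseteq> block (Des T) (Suc j)"
  proof
    fix y assume y: "y \<in> {i + m + 1..i + 2 * m}"
    then show "y \<in> block (Des T) (Suc j)"
      using fwd(3)[of y] block_Des_iff[OF v(1) pos, of "Suc j" y] jl v(6) rng by auto
  qed
qed

text \<open>\<open>destd\<close> is injective on vertices, so only the label is left. Distinct
  descents have distinct levels, so \<open>j\<close> determines the descent \<open>i + m\<close>,
  and the count in \<open>CS_edges_l_facts\<close> determines \<open>m\<close>.\<close>

lemma inj_on_edge_map: "inj_on edge_map (CS_edges_l lam (length lam))"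
proof (rule inj_onI)
  fix e1 e2 assume e: "e1 \<in> CS_edges_l lam (length lam)" "e2 \<in> CS_edges_l lam (length lam)"
    and eq: "edge_map e1 = edge_map e2"
  obtain T1 i1 m1 T1' where e1: "e1 = (T1, (i1, m1), T1')" by (metis surj_pair)
  obtain T2 i2 m2 T2' where e2: "e2 = (T2, (i2, m2), T2')" by (metis surj_pair)
  note f1 = CS_edges_l_facts[OF e(1)[unfolded e1] refl]
  note f2 = CS_edges_l_facts[OF e(2)[unfolded e2] refl]
  have inj: "inj_on destd (CS_vertices_l lam (length lam))"
    using bij_betw_destd[OF part ne] by (rule bij_betw_imp_inj_on)
  have T: "T1 = T2" "T1' = T2'"
    using eq inj f1(1,2) f2(1,2) by (auto simp: edge_map_def e1 e2 inj_on_def)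
  define t where "t = row T1"
  have perm: "is_perm t" using vertex_facts(2)[OF f1(1)] by (simp add: t_def)
  have j: "lvl t (i1 + m1) = lvl t (i2 + m2)" using eq T by (simp add: edge_map_def e1 e2 t_def)
  have D: "i1 + m1 = i2 + m2"
    using wdes_lvl_less[OF perm, of "i1 + m1" "i2 + m2"] wdes_lvl_less[OF perm, of "i2 + m2" "i1 + m1"]
      f1(3) f2(3) j T by (metis less_irrefl linorder_neqE_nat t_def)
  \<comment> \<open>Both factorizations are cut at the last unbracketed \<open>j\<close>, so they
    agree, and with them the two counts.\<close>
  have "m1 = m2"
    using f1(7) f2(7) unfolding D T by (metis append_eq_append_conv list.inject)
  then show "e1 = e2" using D T e1 e2 by simp
qed

lemma edge_map_image: "edge_map ` CS_edges_l lam (length lam) = crystal_edges lam (length lam)"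
proof
  show "edge_map ` CS_edges_l lam (length lam) \<subseteq> crystal_edges lam (length lam)"
    using CS_edges_l_facts(4)[OF _ refl] by (auto simp: edge_map_def)
  show "crystal_edges lam (length lam) \<subseteq> edge_map ` CS_edges_l lam (length lam)"
  proof
    fix e assume "e \<in> crystal_edges lam (length lam)"
    then obtain b j b' where e: "e = (b, j, b')" "b \<in> SSYT lam (length lam)" "b' \<in> SSYT lam (length lam)"
      "f_tab j b = Some b'" by (auto simp: crystal_edges_def)
    define T where "T = std b"
    define T' where "T' = std b'"
    note dT = destd_std[OF part ne e(2), folded T_def]
    note dT' = destd_std[OF part ne e(3), folded T'_def]
    note v = vertex_facts[OF dT(2)] and v' = vertex_facts[OF dT'(2)]
    have f: "f_word j (map (lvl (row T)) (row T)) = Some (row b')"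
      using e(4) v(7) dT(1) by (simp add: f_tab_row)
    \<comment> \<open>\<open>b'\<close> contains \<open>j + 1\<close>, which is at most the number
      of rows; so \<open>j\<close> is not the top level.\<close>
    have "Suc j \<in> set (row b')" using f by (auto simp: f_word_iff)
    then have jl: "j \<le> card (wdes (row T))" using SSYT_set_row[OF part e(3)] v(3) by auto
    from edge_backward[OF v(2,9) f jl] obtain i m c where c: "dyck_interval (row T) i m"
      "f_word i (map (merge_letter i m) (row T)) = Some c" "std_word c = std_word (row b')" .
    then have "(T, (i, m), T') \<in> CS_edges lam"
      unfolding CS_edges_iff using v(1) v'(4) by (auto simp: T'_def row_std)
    then have edge: "(T, (i, m), T') \<in> CS_edges_l lam (length lam)"
      using dT(2) dT'(2) by (simp add: CS_edges_l_def)
    define j' where "j' = lvl (row T) (i + m)"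
    have "f_tab j' b = Some b'"
      using CS_edges_l_facts(4)[OF edge j'_def] dT(1) dT'(1) by (simp add: crystal_edges_def)
    then have f': "f_word j' (row b) = Some (row b')" by (simp add: f_tab_row)
    \<comment> \<open>Both operators turn the word of \<open>b\<close> into that of
      \<open>b'\<close>; the words differ in one place only, and the old letter there is the
      label.\<close>
    have "j' = j"
    proof -
      have "f_word j (row b) = Some (row b')" using e(4) by (simp add: f_tab_row)
      then obtain p where p: "p < length (row b)" "row b ! p = j" "row b' = (row b)[p := Suc j]"
        by (rule f_word_updateD)
      obtain p' where p': "p' < length (row b)" "row b ! p' = j'" "row b' = (row b)[p' := Suc j']"
        using f' by (rule f_word_updateD)
      have "row b' ! p' = Suc j'" using p' by simp
      then have "p = p'" using p p' by (cases "p = p'") auto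
      then show ?thesis using p p' by simp
    qed
    then have "e = edge_map (T, (i, m), T')"
      using e(1) dT(1) dT'(1) by (simp add: edge_map_def j'_def)
    then show "e \<in> edge_map ` CS_edges_l lam (length lam)" using edge by (rule image_eqI)
  qed
qed

end

theorem theorem4p37:
  fixes lam :: "nat list"
  assumes "is_partition lam" and "lam \<noteq> []"
  shows "bij_betw destd (CS_vertices_l lam (length lam)) (SSYT lam (length lam))
    \<and> (\<forall>T\<in>CS_vertices_l lam (length lam). weight (length lam) (destd T) = Des T)
    \<and> (\<exists>\<psi>. bij_betw \<psi> (CS_edges_l lam (length lam)) (crystal_edges lam (length lam))
         \<and> (\<forall>T i m T'. (T, (i, m), T') \<in> CS_edges_l lam (length lam) \<longrightarrow>
              (\<exists>j. \<psi> (T, (i, m), T') = (destd T, j, destd T')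
                   \<and> {i..i + m} \<subseteq> block (Des T) j
                   \<and> {i + m + 1..i + 2 * m} \<subseteq> block (Des T) (Suc j))))"
proof (intro conjI ballI)
  show "bij_betw destd (CS_vertices_l lam (length lam)) (SSYT lam (length lam))"
    by (rule bij_betw_destd[OF assms])
  fix T assume "T \<in> CS_vertices_l lam (length lam)"
  note v = vertex_facts[OF assms this]
  show "weight (length lam) (destd T) = Des T"
    using weight_destd[OF v(1)] sum_list_partition_pos[OF assms] v(6) by simp
next
  have "bij_betw edge_map (CS_edges_l lam (length lam)) (crystal_edges lam (length lam))"
    using inj_on_edge_map[OF assms] edge_map_image[OF assms] by (simp add: bij_betw_def)
  then show "\<exists>\<psi>. bij_betw \<psi> (CS_edges_l lam (length lam)) (crystal_edges lam (length lam))
         \<and> (\<forall>T i m T'. (T, (i, m), T') \<in> CS_edges_l lam (length lam) \<longrightarrow>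
              (\<exists>j. \<psi> (T, (i, m), T') = (destd T, j, destd T')
                   \<and> {i..i + m} \<subseteq> block (Des T) j
                   \<and> {i + m + 1..i + 2 * m} \<subseteq> block (Des T) (Suc j)))"
  proof (intro exI[of _ edge_map] conjI allI impI)
    fix T i m T' assume edge: "(T, (i, m), T') \<in> CS_edges_l lam (length lam)"
    show "\<exists>j. edge_map (T, (i, m), T') = (destd T, j, destd T')
        \<and> {i..i + m} \<subseteq> block (Des T) j \<and> {i + m + 1..i + 2 * m} \<subseteq> block (Des T) (Suc j)"
      using CS_edges_l_facts(5,6)[OF assms edge refl]
      by (intro exI[of _ "lvl (row T) (i + m)"]) (simp add: edge_map_def)
  qed
qed

end
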